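(* Let $n\geq 3$ be an integer. Then no nonzero nilpotent adjoint orbit $\mathcal{O}$ of $\mathfrak{sl}(n,\mathbb{R})$ admits a Gibbs state; that is, for every nonzero nilpotent matrix $x\in\mathfrak{sl}(n,\mathbb{R})$ with orbit $\mathcal{O}=\{gxg^{-1} : g\in \mathrm{SL}(n,\mathbb{R})\}$ one has $\Omega_{\mathcal{O}}=\varnothing$, i.e. for every $\beta\in\mathfrak{sl}(n,\mathbb{R})$, $$\int_{\mathcal{O}} e^{-\kappa(y,\beta)}\,|\lambda_{\mathcal{O}}|(y)=+\infty .$$
   Context: $\kappa$ denotes the Killing form of $\mathfrak{sl}(n,\mathbb{R})$. Adjoint orbits of $\mathfrak{sl}(n,\mathbb{R})$ are the orbits of $\mathrm{SL}(n,\mathbb{R})$ acting by conjugation. An adjoint orbit $\mathcal{O}$ carries the Kirillov–Kostant–Souriau symplectic form $\omega_{\mathcal{O}}$, given at $y\in\mathcal{O}$ by $\omega_{\mathcal{O}}(X^*,Y^* )(y)=\kappa(y,[X,Y])$ for $X,Y\in\mathfrak{sl}(n,\mathbb{R})$, where $X^*$ is the fundamental vector field of $X$ for the adjoint action (value $[X,y]$ at $y$, up to a sign convention that does not affect $\omega_{\mathcal{O}}$). If $\dim\mathcal{O}=2d$, the Liouville volume form is $\lambda_{\mathcal{O}}=\omega_{\mathcal{O}}^{d}$, and $|\lambda_{\mathcal{O}}|$ is the associated positive density (measure). $\Omega_{\mathcal{O}}$ is the set of $\beta\in\mathfrak{sl}(n,\mathbb{R})$ for which $Z(\beta)=\int_{\mathcal{O}}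 e^{-\kappa(y,\beta)}|\lambda_{\mathcal{O}}|(y)$ is finite; to each $\beta\in\Omega_{\mathcal{O}}$ is associated the probability distribution $Z(\beta)^{-1}e^{-\kappa(y,\beta)}|\lambda_{\mathcal{O}}|(y)$, called a Gibbs state. *)

theory Defs
  imports "HOL-Analysis.Analysis" "HOL-Combinatorics.Permutations"
begin

section \<open>The Lie algebra sl(n,R) and its adjoint orbits\<close>

definition sl :: "(real^'n^'n) set" where
  "sl = {X. trace X = 0}"

definition SL :: "(real^'n^'n) set" where
  "SL = {g. det g = 1}"

definition bracket :: "real^'n^'n \<Rightarrow> real^'n^'n \<Rightarrow> real^'n^'n" where
  "bracket X Y = X ** Y - Y ** X"

text \<open>The type of matrices carries the entrywise product, so the library power is not
  the matrix power.\<close>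

definition nilpotent_matrix :: "real^'n^'n \<Rightarrow> bool" where
  "nilpotent_matrix X \<longleftrightarrow> (\<exists>k::nat. (((**) X) ^^ k) (mat 1) = 0)"

definition adjoint_orbit :: "real^'n^'n \<Rightarrow> (real^'n^'n) set" where
  "adjoint_orbit x = {g ** x ** matrix_inv g | g. g \<in> SL}"

text \<open>Trace of an endomorphism of the linear subspace \<open>V\<close>; it does not depend on the chosen
  basis.\<close>

definition trace_on :: "'a::euclidean_space set \<Rightarrow> ('a \<Rightarrow> 'a) \<Rightarrow> real" where
  "trace_on V f =
     (let B = (SOME B. independent B \<and> span B = V) in \<Sum>b\<in>B. representation B (f b) b)"

definition killing :: "real^'n^'n \<Rightarrow> real^'n^'n \<Rightarrow> real" where
  "killing X Y = trace_on sl (\<lambda>Z. bracket X (bracket Y Z))"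

section \<open>The Kirillov--Kostant--Souriau form and its top power\<close>

definition tangent_space :: "real^'n^'n \<Rightarrow> (real^'n^'n) set" where
  "tangent_space y = (\<lambda>X. bracket X y) ` sl"

definition orbit_dim :: "(real^'n^'n) set \<Rightarrow> nat" where
  "orbit_dim \<O> = (THE m. \<forall>y\<in>\<O>. dim (tangent_space y) = m)"

text \<open>The value at \<open>y\<close> on two tangent vectors \<open>v = [X,y]\<close> and \<open>w = [Y,y]\<close>; the choice of
  \<open>X\<close> and \<open>Y\<close> is immaterial.\<close>

definition kks_form :: "real^'n^'n \<Rightarrow> real^'n^'n \<Rightarrow> real^'n^'n \<Rightarrow> real" where
  "kks_form y v w =
     (THE c. \<exists>X\<in>sl. \<exists>Y\<in>sl. v = bracket X y \<and> w = bracket Y y \<and> c = killing y (bracket X Y))"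

text \<open>The \<open>d\<close>-fold exterior power of a 2-form, evaluated on the vectors
  \<open>v 0, \<dots>, v (2 * d - 1)\<close>. The convention is that of the determinant: the wedge product of a
  \<open>p\<close>-form and a \<open>q\<close>-form is the signed sum over all permutations divided by
  \<open>fact p * fact q\<close>.\<close>

definition wedge_power :: "nat \<Rightarrow> ('a \<Rightarrow> 'a \<Rightarrow> real) \<Rightarrow> (nat \<Rightarrow> 'a) \<Rightarrow> real" where
  "wedge_power d \<omega> v =
     (\<Sum>p | p permutes {..<2 * d}.
        of_int (sign p) * (\<Prod>i<d. \<omega> (v (p (2 * i))) (v (p (2 * i + 1))))) / 2 ^ d"

definition liouville_form ::
    "(real^'n^'n) set \<Rightarrow> real^'n^'n \<Rightarrow> (nat \<Rightarrow> real^'n^'n) \<Rightarrow> real" where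
  "liouville_form \<O> y = wedge_power (orbit_dim \<O> div 2) (kks_form y)"

section \<open>The Liouville measure\<close>

text \<open>The dimension of the orbit varies within a fixed matrix type, so the parameter space
  $\mathbb{R}^m$ is the space of extensional functions on \<open>{..<m}\<close>, topologised by
  \<open>powertop_real {..<m}\<close>.\<close>

definition partial :: "nat \<Rightarrow> ((nat \<Rightarrow> real) \<Rightarrow> 'a::real_normed_vector) \<Rightarrow> (nat \<Rightarrow> real) \<Rightarrow> 'a" where
  "partial i \<phi> u = vector_derivative (\<lambda>t. \<phi> (u(i := t))) (at (u i))"

definition C1_map :: "nat \<Rightarrow> (nat \<Rightarrow> real) set \<Rightarrow> ((nat \<Rightarrow> real) \<Rightarrow> 'a::real_normed_vector) \<Rightarrow> bool" where
  "C1_map m U \<phi> \<longleftrightarrow>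
     (\<forall>i<m. (\<forall>u\<in>U. (\<lambda>t. \<phi> (u(i := t))) differentiable at (u i)) \<and>
            continuous_map (subtopology (powertop_real {..<m}) U) euclidean (partial i \<phi>))"

text \<open>A parametrization is an injective immersion of an open subset of $\mathbb{R}^m$, where \<open>m\<close>
  is the dimension of the orbit. Since adjoint orbits are embedded submanifolds, these are exactly
  the inverses of charts. Class $C^1$ is all that the change of variables formula requires.\<close>

definition parametrization ::
    "(real^'n^'n) set \<Rightarrow> (nat \<Rightarrow> real) set \<Rightarrow> ((nat \<Rightarrow> real) \<Rightarrow> real^'n^'n) \<Rightarrow> bool" where
  "parametrization \<O> U \<phi> \<longleftrightarrow>
     openin (powertop_real {..<orbit_dim \<O>}) U \<and> \<phi> ` U \<subseteq> \<O> \<and> inj_on \<phi> U \<and>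
     C1_map (orbit_dim \<O>) U \<phi> \<and>
     (\<forall>u\<in>U. inj_on (\<lambda>i. partial i \<phi> u) {..<orbit_dim \<O>} \<and>
            independent ((\<lambda>i. partial i \<phi> u) ` {..<orbit_dim \<O>}))"

text \<open>The density \<open>|\<lambda>|\<close> over the image of a single parametrization.\<close>

definition chart_measure ::
    "(real^'n^'n) set \<Rightarrow> (nat \<Rightarrow> real) set \<Rightarrow> ((nat \<Rightarrow> real) \<Rightarrow> real^'n^'n) \<Rightarrow> (real^'n^'n) measure" where
  "chart_measure \<O> U \<phi> =
     distr (density (restrict_space (\<Pi>\<^sub>M i\<in>{..<orbit_dim \<O>}. lborel) U)
              (\<lambda>u. ennreal \<bar>liouville_form \<O> (\<phi> u) (\<lambda>i. partial i \<phi> u)\<bar>))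
           (restrict_space borel \<O>) \<phi>"

text \<open>By the change of variables formula the chart measures are the restrictions of one measure
  to the images of the parametrizations. Countably many of these images cover the orbit, so that
  measure is the supremum of the chart measures in the lattice of measures.\<close>

definition liouville_measure :: "(real^'n^'n) set \<Rightarrow> (real^'n^'n) measure" where
  "liouville_measure \<O> =
     (SUP (U, \<phi>) \<in> {(U, \<phi>). parametrization \<O> U \<phi>}. chart_measure \<O> U \<phi>)"

section \<open>Gibbs states\<close>

definition partition_function :: "(real^'n^'n) set \<Rightarrow> real^'n^'n \<Rightarrow> ennreal" where
  "partition_function \<O> \<beta> = (\<integral>\<^sup>+ y. ennreal (exp (- killing y \<beta>)) \<partial>liouville_measure \<O>)"

definition gibbs_domain :: "(real^'n^'n) set \<Rightarrow> (real^'n^'n) set" where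
  "gibbs_domain \<O> = {\<beta>\<in>sl. partition_function \<O> \<beta> < \<infinity>}"

end

theory Submission
  imports Defs
begin

text \<open>The orbit is a cone, since a nilpotent matrix is conjugate to all its positive multiples, and
  scaling by \<open>c\<close> multiplies the Liouville measure by \<open>c^d\<close>, where \<open>2 d > 0\<close> is the dimension of the
  orbit. Hence the integral is infinite as soon as \<open>\<kappa>(y, \<beta>)\<close>, a positive multiple of \<open>tr (y \<beta>)\<close>, is nonpositive
  on a nonempty open subset of the orbit. For \<open>\<beta> = 0\<close> this is trivial.
  Otherwise, the orbit accumulates at every rank one nilpotent matrix \<open>u q\<^sup>T\<close>; for \<open>n \<ge> 3\<close> those form a
  single \<open>SL\<close>-orbit, which is symmetric under negation, and \<open>q \<bullet> \<beta> u < 0\<close> for some orthogonal pair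
  because \<open>\<beta>\<close> is not scalar.\<close>

section \<open>The Killing form and the Kirillov--Kostant--Souriau form\<close>

text \<open>The Liouville measure is a supremum of chart measures, so one chart at each scale
  already bounds the integral from below. Around a point \<open>y\<close> of the orbit with
  \<open>\<beta> = 0\<close> or \<open>trace (y ** \<beta>) < 0\<close>, a small cube in a slice
  transversal to the centralizer of \<open>y\<close> is mapped into the orbit by conjugation and
  then multiplied by \<open>t\<^sup>2\<close>. The cube does not depend on \<open>t\<close>, and its
  contribution grows like the power \<open>2 * d\<close> of \<open>t\<close>. The delicate point is
  that the Liouville density must stay away from zero on the cube. At the centre the slice has a
  basis in symplectic normal form, on which the top power is a sum of nonnegative terms with one
  term equal to 1; continuity does the rest. The bound on n cannot be dropped: for n = 2 the nonzero
  nilpotent matrices form two half-cones exchanged by negation, and some \<beta> makes \<kappa>(y,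
  \<beta>) positive on all of one half-cone.\<close>

lemma bounded_bilinear_matrix_mult:
  "bounded_bilinear ((**) :: real^'n^'n \<Rightarrow> real^'n^'n \<Rightarrow> real^'n^'n)"
  unfolding bilinear_conv_bounded_bilinear [symmetric] bilinear_def
  by (auto intro!: linearI simp: vec_eq_iff matrix_matrix_mult_def sum.distrib algebra_simps
      sum_distrib_left)

interpretation matmul: bounded_bilinear "(**) :: real^'n^'n \<Rightarrow> real^'n^'n \<Rightarrow> real^'n^'n"
  by (rule bounded_bilinear_matrix_mult)

lemmas matrix_ring_simps =
  matmul.add_left matmul.add_right matmul.diff_left matmul.diff_right
  matmul.minus_left matmul.minus_right matmul.scaleR_left matmul.scaleR_right
  matrix_mul_assoc

lemma linear_trace: "linear (trace :: real^'n^'n \<Rightarrow> real)"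
  by (rule linearI) (auto simp: trace_def sum.distrib sum_distrib_left)

lemmas trace_linear_simps =
  linear_0 [OF linear_trace] linear_add [OF linear_trace] linear_diff [OF linear_trace]
  linear_neg [OF linear_trace] linear_scale [OF linear_trace]

lemma bounded_linear_trace: "bounded_linear (trace :: real^'n^'n \<Rightarrow> real)"
  using linear_trace linear_conv_bounded_linear by blast

lemmas continuous_on_trace [continuous_intros] =
  bounded_linear.continuous_on [OF bounded_linear_trace]

lemmas continuous_on_matmul [continuous_intros] = matmul.continuous_on

lemma trace_mult_transpose: "trace (A ** transpose B) = A \<bullet> (B :: real^'n^'n)"
  by (simp add: trace_def matrix_matrix_mult_def transpose_def inner_vec_def)

lemma trace_nondegenerate:
  fixes A :: "real^'n^'n"
  assumes "\<And>B. trace (A ** B) = 0"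
  shows "A = 0"
  using assms [of "transpose A"] by (simp add: trace_mult_transpose)

lemma trace_bracket [simp]: "trace (bracket A B) = (0::real)"
  by (simp add: bracket_def trace_linear_simps trace_mul_sym [of A B])

lemma bracket_in_sl [simp]: "bracket A B \<in> sl"
  by (simp add: sl_def)

lemma trace_bracket_left: "trace (A ** bracket B C) = trace (bracket A B ** (C::real^'n^'n))"
proof -
  have "trace (A ** C ** B) = trace (B ** A ** C)"
    by (metis matrix_mul_assoc trace_mul_sym)
  moreover have "A ** bracket B C = A ** B ** C - A ** C ** B"
    unfolding bracket_def matmul.diff_right matrix_mul_assoc ..
  moreover have "bracket A B ** C = A ** B ** C - B ** A ** C"
    unfolding bracket_def matmul.diff_left ..
  ultimately show ?thesis
    by (simp only: linear_diff [OF linear_trace])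
qed

text \<open>A map with range in \<open>V\<close> induces zero on the quotient by \<open>V\<close>,
  so its trace on \<open>V\<close> is its trace on the whole space. The arbitrary basis in
  \<open>trace_on\<close> can therefore be exchanged for the orthonormal one, which consists of the
  matrix units in the case at hand.\<close>

lemma trace_on_eq_sum_Basis:
  fixes f :: "'a::euclidean_space \<Rightarrow> 'a"
  assumes "linear f" "range f \<subseteq> V" "subspace V"
  shows "trace_on V f = (\<Sum>e\<in>Basis. f e \<bullet> e)"
proof -
  have ex: "\<exists>B. independent B \<and> span B = V"
    by (metis assms(3) basis_exists span_minimal subset_antisym span_eq_iff)
  define B where "B = (SOME B. independent B \<and> span B = V)"
  have B: "independent B" "span B = V"
    using someI_ex [OF ex] by (auto simp: B_def)
  have fin: "finite B" using B independent_imp_finite by blast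
  have mem: "f v \<in> span B" for v using assms B by blast
  have rep: "f v = (\<Sum>b\<in>B. representation B (f v) b *\<^sub>R b)" for v
    using sum_representation_eq [OF B(1) mem fin, of v] by simp
  have lin: "linear (\<lambda>v. representation B (f v) b)" for b
    using assms(1) mem B(1)
    by (intro linearI) (auto simp: linear_add linear_scale representation_add representation_scale)
  have "(\<Sum>e\<in>Basis. f e \<bullet> e) = (\<Sum>e\<in>Basis. \<Sum>b\<in>B. representation B (f e) b * (b \<bullet> e))"
    by (subst rep) (simp add: inner_sum_left)
  also have "\<dots> = (\<Sum>b\<in>B. \<Sum>e\<in>Basis. (b \<bullet> e) * representation B (f e) b)"
    by (subst sum.swap) (simp add: mult.commute)
  also have "\<dots> = (\<Sum>b\<in>B. representation B (f (\<Sum>e\<in>Basis. (b \<bullet> e) *\<^sub>R e)) b)"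
  proof (rule sum.cong [OF refl])
    fix b assume "b \<in> B"
    interpret l: linear "\<lambda>v. representation B (f v) b" by (rule lin)
    show "(\<Sum>e\<in>Basis. (b \<bullet> e) * representation B (f e) b) =
      representation B (f (\<Sum>e\<in>Basis. (b \<bullet> e) *\<^sub>R e)) b"
      by (simp only: l.sum l.scale real_scaleR_def)
  qed
  also have "\<dots> = trace_on V f"
    by (simp add: trace_on_def B_def [symmetric] Let_def euclidean_representation)
  finally show ?thesis by simp
qed

lemma sum_Basis_matrix:
  "(\<Sum>e\<in>(Basis :: (real^'n^'n) set). h e) = (\<Sum>i\<in>UNIV. \<Sum>j\<in>UNIV. h (axis i (axis j 1)))"
proof -
  have "(Basis :: (real^'n^'n) set) = (\<lambda>(i, j). axis i (axis j 1)) ` (UNIV \<times> UNIV)"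
    by (auto simp: Basis_vec_def image_iff)
  moreover have "inj (\<lambda>(i, j). axis i (axis j (1::real)) :: real^'n^'n)"
    by (auto simp: inj_def axis_eq_axis)
  ultimately have "(\<Sum>e\<in>(Basis :: (real^'n^'n) set). h e) =
      (\<Sum>p\<in>UNIV \<times> UNIV. h (case p of (i, j) \<Rightarrow> axis i (axis j 1)))"
    by (metis sum.reindex [unfolded comp_def] inj_on_subset subset_UNIV)
  then show ?thesis
    by (simp only: sum.cartesian_product case_prod_beta')
qed

lemma inner_matrix_unit: "(A::real^'n^'n) \<bullet> axis i (axis j 1) = A $ i $ j"
  by (simp add: inner_axis)

lemma matrix_unit_sandwich:
  "(A ** axis i (axis j 1) ** B) $ k $ l = (A :: real^'n^'n) $ k $ i * B $ j $ l"
proof -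
  have 1: "(A ** axis i (axis j 1)) $ k $ m = (if m = j then A $ k $ i else 0)" for m
  proof -
    have "(A ** axis i (axis j 1)) $ k $ m =
        (\<Sum>a\<in>UNIV. if a = i then (if m = j then A $ k $ i else 0) else 0)"
      unfolding matrix_matrix_mult_def vec_lambda_beta
      by (rule sum.cong) (auto simp: axis_def)
    then show ?thesis by simp
  qed
  have "(A ** axis i (axis j 1) ** B) $ k $ l =
      (\<Sum>m\<in>UNIV. (A ** axis i (axis j 1)) $ k $ m * B $ m $ l)"
    by (simp add: matrix_matrix_mult_def)
  also have "\<dots> = (\<Sum>m\<in>UNIV. if m = j then A $ k $ i * B $ j $ l else 0)"
    by (rule sum.cong) (auto simp: 1)
  finally show ?thesis by simp
qed

text \<open>The double bracket is a sum of four maps of the form Z \<mapsto> A Z B, and such a map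
  has trace tr A tr B on the space of all matrices. Brackets are traceless, so this is also the
  trace on \<open>sl\<close>. When one argument is traceless, only the multiple of
  \<open>trace (X ** Y)\<close> survives.\<close>

lemma killing_eq:
  "killing X (Y :: real^'n^'n) = 2 * real CARD('n) * trace (X ** Y) - 2 * trace X * trace Y"
proof -
  let ?f = "\<lambda>Z. bracket X (bracket Y Z)"
  have sub: "subspace (sl :: (real^'n^'n) set)"
    by (auto simp: sl_def subspace_def trace_linear_simps)
  have "linear ?f"
    by (rule linearI) (auto simp: bracket_def matrix_ring_simps algebra_simps)
  then have "killing X Y = (\<Sum>e\<in>Basis. ?f e \<bullet> e)"
    unfolding killing_def by (rule trace_on_eq_sum_Basis) (auto simp: sub)
  also have "\<dots> = (\<Sum>i\<in>UNIV. \<Sum>j\<in>UNIV. ?f (axis i (axis j 1)) $ i $ j)"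
    by (simp add: sum_Basis_matrix inner_matrix_unit)
  also have "\<dots> = (\<Sum>i\<in>UNIV. \<Sum>j\<in>UNIV. (X ** Y) $ i $ i * (mat 1 $ j $ j)
     - X $ i $ i * Y $ j $ j - Y $ i $ i * X $ j $ j + mat 1 $ i $ i * (Y ** X) $ j $ j)"
  proof (intro sum.cong refl)
    fix i j :: 'n
    let ?E = "axis i (axis j 1) :: real^'n^'n"
    have "?f ?E = (X ** Y) ** ?E ** mat 1 - X ** ?E ** Y - Y ** ?E ** X + mat 1 ** ?E ** (Y ** X)"
      by (simp add: bracket_def matrix_ring_simps)
    then show "?f ?E $ i $ j = (X ** Y) $ i $ i * (mat 1 $ j $ j)
     - X $ i $ i * Y $ j $ j - Y $ i $ i * X $ j $ j + mat 1 $ i $ i * (Y ** X) $ j $ j"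
      by (simp only: vector_add_component vector_minus_component matrix_unit_sandwich)
  qed
  also have "\<dots> = trace (X ** Y) * trace (mat 1 :: real^'n^'n) - trace X * trace Y
      - trace Y * trace X + trace (mat 1 :: real^'n^'n) * trace (Y ** X)"
    unfolding trace_def sum.distrib sum_subtractf sum_product ..
  also have "\<dots> = 2 * real CARD('n) * trace (X ** Y) - 2 * trace X * trace Y"
    by (simp add: trace_I trace_mul_sym [of Y X])
  finally show ?thesis .
qed

text \<open>Removing the scalar part frees later arguments from the trace condition: tangent vectors
  are written with matrices such as \<open>E ** matrix_inv A\<close>, whose trace is not
  controlled.\<close>

lemma bracket_lift_sl:
  "\<exists>X' \<in> sl. bracket X' y = bracket X (y :: real^'n^'n)"
proof
  let ?X = "X - (trace X / real CARD('n)) *\<^sub>R mat 1"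
  show "?X \<in> sl" by (simp add: sl_def trace_linear_simps trace_I)
  show "bracket ?X y = bracket X y"
    by (simp add: bracket_def matrix_ring_simps)
qed

lemma bracket_minus_comm: "bracket A B = - bracket B (A :: real^'n^'n)"
  by (simp add: bracket_def)

text \<open>By invariance of the trace form, tr(y [A, B]) depends on A only through [A, y] and on B
  only through [B, y]. Hence the definite description in \<open>kks_form\<close> is well defined and
  any lifts may be inserted.\<close>

lemma kks_form_bracket:
  fixes y :: "real^'n^'n"
  shows "kks_form y (bracket X y) (bracket Y y) = 2 * real CARD('n) * trace (y ** bracket X Y)"
proof -
  have eq: "trace (y ** bracket A B) = trace (y ** bracket X Y)"
    if "bracket A y = bracket X y" "bracket B y = bracket Y y" for A B
  proof -
    have "trace (y ** bracket A B) = - trace (bracket A y ** B)"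
      by (simp add: trace_bracket_left bracket_minus_comm [of y A] matmul.minus_left trace_linear_simps)
    also have "\<dots> = - trace (bracket X y ** B)" using that by simp
    also have "\<dots> = - trace (X ** bracket y B)" by (simp add: trace_bracket_left)
    also have "\<dots> = trace (X ** bracket B y)"
      by (simp add: bracket_minus_comm [of y B] matmul.minus_right trace_linear_simps)
    also have "\<dots> = trace (X ** bracket Y y)" using that by simp
    also have "\<dots> = - trace (bracket X y ** Y)"
      by (simp add: bracket_minus_comm [of Y y] matmul.minus_right trace_linear_simps trace_bracket_left)
    also have "\<dots> = trace (y ** bracket X Y)"
      by (simp add: trace_bracket_left bracket_minus_comm [of y X] matmul.minus_left trace_linear_simps)
    finally show ?thesis .
  qed
  have kil: "killing y (bracket A B) = 2 * real CARD('n) * trace (y ** bracket A B)" for A B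
    by (simp add: killing_eq)
  obtain X' where X': "X' \<in> sl" "bracket X' y = bracket X y"
    using bracket_lift_sl by blast
  obtain Y' where Y': "Y' \<in> sl" "bracket Y' y = bracket Y y"
    using bracket_lift_sl by blast
  show ?thesis
    unfolding kks_form_def
  proof (rule the_equality)
    show "\<exists>A\<in>sl. \<exists>B\<in>sl. bracket X y = bracket A y \<and> bracket Y y = bracket B y \<and>
        2 * real CARD('n) * trace (y ** bracket X Y) = killing y (bracket A B)"
      using X' Y' eq [OF X'(2) Y'(2)] by (intro bexI [of _ X'] bexI [of _ Y']) (simp_all add: kil)
  next
    fix c
    assume "\<exists>A\<in>sl. \<exists>B\<in>sl. bracket X y = bracket A y \<and> bracket Y y = bracket B y \<and>
        c = killing y (bracket A B)"
    then show "c = 2 * real CARD('n) * trace (y ** bracket X Y)"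
      using kil eq by metis
  qed
qed

section \<open>Conjugation and tangent spaces\<close>

lemma matrix_inv:
  fixes g :: "real^'n^'n"
  assumes "det g \<noteq> 0"
  shows "g ** matrix_inv g = mat 1" "matrix_inv g ** g = mat 1"
proof -
  have "\<exists>h. g ** h = mat 1 \<and> h ** g = mat 1"
    using assms by (simp add: invertible_det_nz [symmetric] invertible_def)
  then have "g ** matrix_inv g = mat 1 \<and> matrix_inv g ** g = mat 1"
    unfolding matrix_inv_def by (rule someI_ex)
  then show "g ** matrix_inv g = mat 1" "matrix_inv g ** g = mat 1" by auto
qed

lemma matrix_inv_cancel:
  fixes g :: "real^'n^'n"
  assumes "det g \<noteq> 0"
  shows "A ** g ** matrix_inv g = A" "A ** matrix_inv g ** g = A"
  by (simp_all add: matrix_inv [OF assms] flip: matrix_mul_assoc)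

lemma matrix_inv_unique:
  fixes g :: "real^'n^'n"
  assumes "g ** h = mat 1"
  shows "matrix_inv g = h"
proof -
  have "det g * det h = 1" using assms by (metis det_I det_mul)
  then have "det g \<noteq> 0" by auto
  then have "matrix_inv g ** (g ** h) = h"
    by (simp add: matrix_mul_assoc matrix_inv)
  then show ?thesis by (simp add: assms)
qed

lemma conj_mult:
  fixes g :: "real^'n^'n"
  assumes "det g \<noteq> 0" "det h \<noteq> 0"
  shows "(g ** h) ** x ** matrix_inv (g ** h) = g ** (h ** x ** matrix_inv h) ** matrix_inv g"
proof -
  have "matrix_inv (g ** h) = matrix_inv h ** matrix_inv g"
    by (rule matrix_inv_unique) (simp add: matrix_mul_assoc matrix_inv_cancel matrix_inv assms)
  then show ?thesis by (simp add: matrix_mul_assoc)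
qed

lemma det_scaleR: "det (c *\<^sub>R (A :: real^'n^'n)) = c ^ CARD('n) * det A"
proof -
  have "det (matrix ((*\<^sub>R) c) ** A) = c ^ CARD('n) * det A"
    by (simp add: det_mul)
  moreover have "matrix ((*\<^sub>R) c) ** A = c *\<^sub>R A"
    by (simp add: matrix_eq scaleR_matrix_vector_assoc [symmetric] flip: matrix_vector_mul_assoc)
  ultimately show ?thesis by simp
qed

text \<open>Dividing \<open>g\<close> by the n-th root of its determinant does not change the
  conjugation. The condition det > 0 is open, unlike det = 1, so a whole neighbourhood of the
  identity acts on the orbit.\<close>

lemma adjoint_orbit_iff:
  "y \<in> adjoint_orbit (x :: real^'n^'n) \<longleftrightarrow> (\<exists>g. det g > 0 \<and> y = g ** x ** matrix_inv g)"
proof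
  assume "y \<in> adjoint_orbit x"
  then obtain g where "det g = 1" "y = g ** x ** matrix_inv g"
    unfolding adjoint_orbit_def SL_def by blast
  then show "\<exists>g. det g > 0 \<and> y = g ** x ** matrix_inv g"
    by (intro exI [of _ g]) simp
next
  assume "\<exists>g. det g > 0 \<and> y = g ** x ** matrix_inv g"
  then obtain g where g: "det g > 0" "y = g ** x ** matrix_inv g" by auto
  define c where "c = 1 / root CARD('n) (det g)"
  have c: "c > 0" using g by (simp add: c_def)
  have "c ^ CARD('n) = 1 / det g"
    using g by (simp add: c_def power_divide)
  then have det: "det (c *\<^sub>R g) = 1" using g by (simp add: det_scaleR)
  have "matrix_inv (c *\<^sub>R g) = (1/c) *\<^sub>R matrix_inv g"
    by (rule matrix_inv_unique) (use c g in \<open>simp add: matrix_ring_simps matrix_inv\<close>)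
  then have "y = (c *\<^sub>R g) ** x ** matrix_inv (c *\<^sub>R g)"
    using c g by (simp add: matrix_ring_simps)
  with det show "y \<in> adjoint_orbit x"
    unfolding adjoint_orbit_def SL_def by blast
qed

lemma adjoint_orbit_conj:
  assumes "y \<in> adjoint_orbit (x :: real^'n^'n)" "det g > 0"
  shows "g ** y ** matrix_inv g \<in> adjoint_orbit x"
proof -
  obtain h where h: "det h > 0" "y = h ** x ** matrix_inv h"
    using assms(1) unfolding adjoint_orbit_iff by blast
  then have "g ** y ** matrix_inv g = (g ** h) ** x ** matrix_inv (g ** h)"
    using assms by (simp add: conj_mult)
  then show ?thesis
    using h assms by (auto simp: adjoint_orbit_iff det_mul intro!: exI [of _ "g ** h"])
qed

lemma trace_conj:
  assumes "det g \<noteq> 0"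
  shows "trace (g ** x ** matrix_inv g) = trace (x :: real^'n^'n)"
proof -
  have "trace (g ** x ** matrix_inv g) = trace (matrix_inv g ** (g ** x))"
    by (rule trace_mul_sym)
  then show ?thesis by (simp add: matrix_mul_assoc matrix_inv assms)
qed

lemma bracket_conj:
  fixes g :: "real^'n^'n"
  assumes "det g \<noteq> 0"
  shows "bracket (g ** X ** matrix_inv g) (g ** Y ** matrix_inv g) = g ** bracket X Y ** matrix_inv g"
  by (simp add: bracket_def matrix_ring_simps matrix_inv_cancel assms)

lemma linear_conj: "linear (\<lambda>X :: real^'n^'n. (g :: real^'n^'n) ** X ** (h :: real^'n^'n))"
  by (rule linearI) (simp_all add: matrix_ring_simps)

lemma inj_conj: "det (g :: real^'n^'n) \<noteq> 0 \<Longrightarrow> inj (\<lambda>X :: real^'n^'n. g ** X ** matrix_inv g)"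
  by (rule inj_on_inverseI [of _ "\<lambda>X. matrix_inv g ** X ** g"])
    (simp add: matrix_mul_assoc matrix_inv matrix_inv_cancel)

lemma tangent_space_eq: "tangent_space y = range (\<lambda>X. bracket X (y :: real^'n^'n))"
proof
  show "tangent_space y \<subseteq> range (\<lambda>X. bracket X y)"
    by (auto simp: tangent_space_def)
  show "range (\<lambda>X. bracket X y) \<subseteq> tangent_space y"
  proof clarify
    fix X
    obtain X' where "X' \<in> sl" "bracket X' y = bracket X y"
      using bracket_lift_sl by blast
    then show "bracket X y \<in> tangent_space y"
      unfolding tangent_space_def by (intro image_eqI [of _ _ X']) simp_all
  qed
qed

lemma tangent_space_conj:
  fixes g :: "real^'n^'n"
  assumes "det g \<noteq> 0"
  shows "tangent_space (g ** y ** matrix_inv g) = (\<lambda>X. g ** X ** matrix_inv g) ` tangent_space y"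
proof -
  have "surj (\<lambda>X :: real^'n^'n. g ** X ** matrix_inv g)"
    using assms by (intro linear_injective_imp_surjective linear_conj inj_conj) auto
  then have "range (\<lambda>X. bracket X (g ** y ** matrix_inv g)) =
      range (\<lambda>X. bracket (g ** X ** matrix_inv g) (g ** y ** matrix_inv g))"
    using image_image [of "\<lambda>X. bracket X (g ** y ** matrix_inv g)" "\<lambda>X. g ** X ** matrix_inv g" UNIV]
    by simp
  then show ?thesis
    by (simp add: tangent_space_eq bracket_conj assms image_image)
qed

lemma orbit_dim_eq:
  fixes x y :: "real^'n^'n"
  assumes "y \<in> adjoint_orbit x"
  shows "orbit_dim (adjoint_orbit x) = dim (tangent_space y)"
proof -
  have "dim (tangent_space z) = dim (tangent_space x)" if z: "z \<in> adjoint_orbit x" for z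
  proof -
    obtain g where g: "det g > 0" "z = g ** x ** matrix_inv g"
      using z unfolding adjoint_orbit_iff by blast
    have "inj_on (\<lambda>X. g ** X ** matrix_inv g) (span (tangent_space x))"
      using g by (intro inj_on_subset [OF inj_conj]) auto
    then show ?thesis
      using g dim_image_eq [OF linear_conj] by (simp add: tangent_space_conj)
  qed
  then show ?thesis
    unfolding orbit_dim_def using assms by (intro the_equality) auto
qed

section \<open>Nilpotent orbits are cones\<close>

text \<open>The restriction of \<open>h\<close> to the range of \<open>x\<close> is given by induction; \<open>h\<close> is extended by a
  solution of \<open>x (h y) = (h (x y)) / t\<close> corrected by vectors in the kernel of \<open>x\<close>.\<close>

lemma nilpotent_scaling_on_subspace:
  fixes x :: "'a::euclidean_space \<Rightarrow> 'a" and t :: real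
  assumes "linear x" "t \<noteq> 0" "subspace V" "x ` V \<subseteq> V" "\<And>y. y \<in> V \<Longrightarrow> (x ^^ k) y = 0"
  shows "\<exists>h. linear h \<and> h ` V \<subseteq> V \<and> (\<forall>y\<in>V. h y = 0 \<longrightarrow> y = 0) \<and> (\<forall>y\<in>V. h (x y) = t *\<^sub>R x (h y))"
  using assms(3-5)
proof (induction k arbitrary: V)
  case 0
  have "y = 0" if "y \<in> V" for y using 0(3) [OF that] by simp
  then show ?case
    using 0 by (intro exI [of _ "\<lambda>y. y"]) (fastforce simp: linear_0 [OF assms(1)] linear_ident)
next
  case (Suc k)
  interpret x: linear x by (rule assms(1))
  define R where "R = x ` V"
  have R: "subspace R" "R \<subseteq> V" "x ` R \<subseteq> R"
    using Suc.prems unfolding R_def by (auto intro: linear_subspace_image [OF assms(1)])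
  have "(x ^^ k) y = 0" if "y \<in> R" for y
    using that Suc.prems(3) by (auto simp: R_def funpow_swap1)
  from Suc.IH [OF R(1,3) this] obtain h0 where h0: "linear h0" "h0 ` R \<subseteq> R"
    "\<And>y. y \<in> R \<Longrightarrow> h0 y = 0 \<Longrightarrow> y = 0" "\<And>y. y \<in> R \<Longrightarrow> h0 (x y) = t *\<^sub>R x (h0 y)"
    by blast
  interpret h0: linear h0 by (rule h0(1))
  \<comment> \<open>\<open>N\<close> is a complement of the kernel of \<open>x\<close> in
    \<open>R\<close> inside the kernel of \<open>x\<close> in \<open>V\<close>. There
    \<open>h\<close> may be chosen freely and will be the identity.\<close>
  define N where "N = {y\<in>V. x y = 0 \<and> (\<forall>z\<in>R. x z = 0 \<longrightarrow> orthogonal z y)}"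
  have N: "subspace N"
    using Suc.prems(1) unfolding N_def subspace_def
    by (auto simp: x.add x.scale x.zero orthogonal_clauses)
  have RN: "r = 0" if "r \<in> R" "r \<in> N" for r
    using that by (auto simp: N_def orthogonal_def)
  have decomp: "\<exists>r\<in>R. \<exists>n\<in>N. x r = 0 \<and> y = r + n" if y: "y \<in> V" "x y = 0" for y
  proof -
    let ?S = "{z \<in> R. x z = 0}"
    have S: "subspace ?S" using R(1) by (auto simp: subspace_def x.add x.scale x.zero)
    obtain r n where rn: "r \<in> span ?S" "\<And>w. w \<in> span ?S \<Longrightarrow> orthogonal n w" "y = r + n"
      using orthogonal_subspace_decomp_exists [of ?S y] by metis
    then have r: "r \<in> R" "x r = 0" using S by (auto simp: span_eq_iff [THEN iffD2])
    have "n = y - r" using rn by simp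
    then have "n \<in> V" "x n = 0"
      using y r R(2) Suc.prems(1) by (auto simp: x.diff subspace_diff)
    then have "n \<in> N" using rn(2) by (auto simp: N_def span_base orthogonal_commute)
    then show ?thesis using r rn by blast
  qed
  have lin_plus: "linear (\<lambda>(r, n). r + n :: 'a)"
    by (rule linearI) (auto simp: algebra_simps)
  have "inj_on (\<lambda>(r, n). r + n) (R \<times> N)"
  proof (clarsimp simp: inj_on_def)
    fix r n r' n' assume *: "r \<in> R" "n \<in> N" "r' \<in> R" "n' \<in> N" "r + n = r' + n'"
    then have "r - r' = n' - n" by (simp add: algebra_simps)
    then have "r - r' = 0" using RN [of "r - r'"] * R(1) N by (metis subspace_diff)
    then show "r = r' \<and> n = n'" using * by simp
  qed
  from linear_exists_left_inverse_on [OF lin_plus subspace_Times [OF R(1) N] this]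
  obtain G where G: "range G \<subseteq> R \<times> N" "linear G" "\<And>r n. r \<in> R \<Longrightarrow> n \<in> N \<Longrightarrow> G (r + n) = (r, n)"
    by auto
  obtain g where g: "range g \<subseteq> V" "linear g" "\<And>v. v \<in> R \<Longrightarrow> x (g v) = v"
    using linear_exists_right_inverse_on [OF assms(1) Suc.prems(1)] unfolding R_def by auto
  interpret G: linear G by (rule G(2))
  interpret g: linear g by (rule g(2))
  \<comment> \<open>\<open>kk\<close> solves x (kk y) = (1/t) h0 (x y) by means of the right inverse
    \<open>g\<close> of \<open>x\<close>. For r in \<open>R\<close> the intertwining property of
    \<open>h0\<close> puts h0 r - kk r into the kernel of \<open>x\<close>, so the correction in
    \<open>h\<close> preserves this equation while making \<open>h\<close> agree with
    \<open>h0\<close> on \<open>R\<close> and with the identity on \<open>N\<close>.\<close>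
  define kk where "kk y = (1/t) *\<^sub>R g (h0 (x y))" for y
  define h where "h y = kk y + (h0 (fst (G y)) - kk (fst (G y))) + snd (G y)" for y
  have lin_h: "linear h"
    unfolding h_def kk_def
    by (rule linearI) (auto simp: G.add g.add h0.add x.add G.scale g.scale h0.scale x.scale algebra_simps)
  have Gy: "fst (G y) \<in> R" "snd (G y) \<in> N" for y
    using G(1) by (auto simp: image_subset_iff mem_Times_iff)
  have xkk: "x (kk y) = (1/t) *\<^sub>R h0 (x y)" if "y \<in> V" for y
    using that h0(2) by (simp add: kk_def x.scale g(3) R_def image_subset_iff)
  have xh: "x (h y) = (1/t) *\<^sub>R h0 (x y)" if "y \<in> V" for y
  proof -
    have "x (h0 (fst (G y))) = (1/t) *\<^sub>R h0 (x (fst (G y)))"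
      using h0(4) [OF Gy(1)] assms(2) by simp
    moreover have "x (snd (G y)) = 0" using Gy(2) by (simp add: N_def)
    ultimately show ?thesis
      using xkk that Gy(1) R(2) by (simp add: h_def x.add x.diff subset_iff)
  qed
  have hRN: "h (r + n) = h0 r + n" if "r \<in> R" "n \<in> N" for r n
  proof -
    have "kk (r + n) = kk r" using that
      by (simp add: kk_def x.add N_def)
    then show ?thesis using G(3) [OF that] by (simp add: h_def)
  qed
  have hR: "h r = h0 r" if "r \<in> R" for r
    using hRN [OF that subspace_0 [OF N]] by simp
  have hV: "h y \<in> V" if "y \<in> V" for y
  proof -
    have "kk z \<in> V" for z
      unfolding kk_def by (rule subspace_scale [OF Suc.prems(1)]) (use g(1) in blast)
    moreover have "h0 (fst (G y)) \<in> V" using h0(2) Gy(1) R(2) by blast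
    moreover have "snd (G y) \<in> V" using Gy(2) by (simp add: N_def)
    ultimately show ?thesis unfolding h_def
      using Suc.prems(1) by (intro subspace_add subspace_diff)
  qed
  \<comment> \<open>If h y = 0, then h0 kills x y, hence x y = 0 and y = r + n splits along
    \<open>R\<close> and \<open>N\<close>. Now h0 r + n = 0 puts n into both \<open>R\<close> and
    \<open>N\<close>, which meet only in 0.\<close>
  have ker: "y = 0" if y: "y \<in> V" "h y = 0" for y
  proof -
    have "x y \<in> R" using y by (simp add: R_def)
    moreover have "h0 (x y) = 0" using xh [OF y(1)] y(2) assms(2) by (simp add: x.zero)
    ultimately have "x y = 0" using h0(3) by blast
    then obtain r n where rn: "r \<in> R" "n \<in> N" "x r = 0" "y = r + n"
      using decomp y(1) by blast
    then have "h0 r + n = 0" using hRN y(2) by simp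
    then have "n = - h0 r" by (simp add: add_eq_0_iff)
    moreover have "- h0 r \<in> R" using h0(2) rn(1) R(1) by (auto simp: subspace_neg)
    ultimately have "n = 0" using RN [of n] rn(2) by simp
    then have "h0 r = 0" using \<open>n = - h0 r\<close> by simp
    then show "y = 0" using h0(3) rn \<open>n = 0\<close> by simp
  qed
  show ?case
  proof (intro exI conjI ballI impI)
    show "linear h" by (rule lin_h)
    show "h ` V \<subseteq> V" using hV by blast
    show "y = 0" if "y \<in> V" "h y = 0" for y using ker that by blast
    show "h (x y) = t *\<^sub>R x (h y)" if "y \<in> V" for y
      using hR [of "x y"] xh [OF that] that assms(2) by (simp add: R_def)
  qed
qed

text \<open>An invertible h with h x = t x h may have negative determinant. Its square has positive
  determinant and scales by the square of t, which is why all scale factors below are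
  squares.\<close>

lemma nilpotent_matrix_scaling:
  fixes x :: "real^'n^'n"
  assumes "nilpotent_matrix x" "t \<noteq> 0"
  shows "\<exists>h. det h > 0 \<and> h ** x = t\<^sup>2 *\<^sub>R (x ** h)"
proof -
  obtain k where k: "(((**) x) ^^ k) (mat 1) = 0"
    using assms by (auto simp: nilpotent_matrix_def)
  have pow: "(((*v) x) ^^ k) y = (((**) x) ^^ k) (mat 1) *v y" for k y
    by (induction k) (simp_all add: matrix_vector_mul_assoc)
  obtain h where h: "linear h" "\<And>y. h y = 0 \<Longrightarrow> y = 0" "\<And>y. h (x *v y) = t *\<^sub>R (x *v h y)"
    using nilpotent_scaling_on_subspace [of "(*v) x" t UNIV k] assms(2)
    by (auto simp: pow k)
  let ?h = "matrix h"
  have mv: "?h *v y = h y" for y by (simp add: h(1))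
  have "det ?h \<noteq> 0"
    using h(2) by (simp add: det_nz_iff_inj mv linear_injective_0 h(1))
  then have pos: "det (?h ** ?h) > 0"
    by (auto simp: det_mul zero_less_mult_iff)
  have hx: "?h ** x = t *\<^sub>R (x ** ?h)"
    by (simp add: matrix_eq mv h(3) scaleR_matrix_vector_assoc [symmetric] flip: matrix_vector_mul_assoc)
  have "(?h ** ?h) ** x = ?h ** (?h ** x)" by (simp add: matrix_mul_assoc)
  also have "\<dots> = ?h ** (t *\<^sub>R (x ** ?h))" by (simp only: hx)
  also have "\<dots> = t *\<^sub>R ((?h ** x) ** ?h)" by (simp add: matrix_ring_simps)
  also have "\<dots> = t *\<^sub>R ((t *\<^sub>R (x ** ?h)) ** ?h)" by (simp only: hx)
  also have "\<dots> = t\<^sup>2 *\<^sub>R (x ** (?h ** ?h))" by (simp add: matrix_ring_simps power2_eq_square)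
  finally show ?thesis using pos by (intro exI [of _ "?h ** ?h"]) simp
qed

lemma nilpotent_orbit_cone:
  fixes x :: "real^'n^'n"
  assumes "nilpotent_matrix x" "y \<in> adjoint_orbit x" "t \<noteq> 0"
  shows "t\<^sup>2 *\<^sub>R y \<in> adjoint_orbit x"
proof -
  obtain h where h: "det h > 0" "h ** x = t\<^sup>2 *\<^sub>R (x ** h)"
    using nilpotent_matrix_scaling assms by blast
  obtain g where g: "det g > 0" "y = g ** x ** matrix_inv g"
    using assms(2) unfolding adjoint_orbit_iff by blast
  have "(g ** h) ** x ** matrix_inv (g ** h) = g ** (h ** x ** matrix_inv h) ** matrix_inv g"
    using g h by (simp add: conj_mult)
  also have "h ** x ** matrix_inv h = t\<^sup>2 *\<^sub>R x"
    using h by (simp add: matrix_ring_simps matrix_inv_cancel)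
  also have "g ** (t\<^sup>2 *\<^sub>R x) ** matrix_inv g = t\<^sup>2 *\<^sub>R y"
    by (simp add: g matrix_ring_simps)
  finally show ?thesis
    unfolding adjoint_orbit_iff using g h by (intro exI [of _ "g ** h"]) (simp add: det_mul)
qed

section \<open>Negative values of linear functionals on orbits\<close>

definition reflection :: "'a::real_inner \<Rightarrow> 'a \<Rightarrow> 'a" where
  "reflection a v = v - (2 * (a \<bullet> v) / (a \<bullet> a)) *\<^sub>R a"

lemma orthogonal_transformation_reflection:
  "orthogonal_transformation (reflection (a :: 'a::euclidean_space))"
proof (cases "a = 0")
  case True
  then show ?thesis by (simp add: reflection_def [abs_def])
next
  case False
  have "linear (reflection a)"
    by (rule linearI) (simp_all add: reflection_def inner_add_right algebra_simps add_divide_distrib)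
  moreover have "reflection a v \<bullet> reflection a w = v \<bullet> w" for v w
    using False by (simp add: reflection_def inner_diff_left inner_diff_right inner_commute field_simps)
  ultimately show ?thesis by (simp add: orthogonal_transformation_def)
qed

text \<open>For vectors of equal norm, the hyperplane orthogonal to \<open>v - w\<close> is their
  mirror. The case \<open>v = w\<close> is covered because \<open>reflection 0\<close> is the
  identity.\<close>

lemma reflection_swap:
  assumes "norm v = norm w"
  shows "reflection (v - w) v = w"
proof (cases "v = w")
  case False
  have "v \<bullet> v = w \<bullet> w" using assms by (simp add: norm_eq)
  then have "(v - w) \<bullet> (v - w) = 2 * ((v - w) \<bullet> v)"
    by (simp add: inner_diff_left inner_diff_right inner_commute)
  moreover have "(v - w) \<bullet> (v - w) \<noteq> 0" using False by simp
  ultimately show ?thesis by (simp add: reflection_def)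
qed (simp add: reflection_def)

lemma reflection_fixes: "a \<bullet> v = 0 \<Longrightarrow> reflection a v = v"
  by (simp add: reflection_def)

text \<open>This is the reflection in the hyperplane orthogonal to \<open>z\<close>, written as an
  orthogonal conjugate of a diagonal matrix so that its determinant can be read off. It serves to
  repair a wrong orientation.\<close>

lemma exists_rotoinversion_fixing:
  fixes z :: "real^'n"
  assumes "z \<noteq> 0"
  obtains S where "orthogonal_matrix S" "det S = -1" "\<And>v. z \<bullet> v = 0 \<Longrightarrow> S *v v = v"
proof -
  define k :: 'n where "k = undefined"
  define b where "b = z /\<^sub>R norm z"
  have "norm b = 1" using assms by (simp add: b_def)
  then obtain A where A: "orthogonal_matrix A" "A *v axis k 1 = b"
    using orthogonal_matrix_exists_basis by metis
  define D :: "real^'n^'n" where "D = (\<chi> i j. if i = j then (if i = k then -1 else 1) else 0)"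
  have "det D = (\<Prod>i\<in>UNIV. if i = k then -1 else 1)"
    by (subst det_diagonal) (auto simp: D_def)
  then have detD: "det D = -1" by simp
  have DT: "transpose D = D"
    by (auto simp: D_def transpose_def vec_eq_iff)
  have Dv: "D *v v = v" if "v $ k = 0" for v
  proof -
    have "(D *v v) $ i = (\<Sum>j\<in>UNIV. if j = i then v $ i else 0)" for i
      unfolding matrix_vector_mult_def D_def vec_lambda_beta
      using that by (intro sum.cong) auto
    then show ?thesis by (simp add: vec_eq_iff)
  qed
  have "D ** D = mat 1"
  proof -
    have "(D ** D) $ i $ j = (\<Sum>l\<in>UNIV. if l = i then (if i = j then 1 else 0) else 0)" for i j
      unfolding matrix_matrix_mult_def D_def vec_lambda_beta
      by (intro sum.cong) auto
    then show ?thesis by (simp add: vec_eq_iff mat_def)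
  qed
  then have D: "orthogonal_matrix D" by (simp add: orthogonal_matrix DT)
  let ?S = "A ** D ** transpose A"
  have AA: "transpose A ** A = mat 1" "A ** transpose A = mat 1"
    using A by (auto simp: orthogonal_matrix_def)
  show thesis
  proof
    show "orthogonal_matrix ?S"
      using A D by (intro orthogonal_matrix_mul) auto
    have "det A * det (transpose A) = 1" using AA by (metis det_I det_mul)
    then show "det ?S = -1" using detD by (simp add: det_mul)
    fix v assume "z \<bullet> v = 0"
    then have "(A *v axis k 1) \<bullet> v = 0" by (simp add: A b_def)
    then have "axis k 1 \<bullet> (transpose A *v v) = 0"
      by (metis dot_lmul_matrix inner_commute transpose_matrix_vector)
    then have "(transpose A *v v) $ k = 0"
      by (simp only: inner_axis inner_commute [of "axis k 1"]) simp
    then have "D *v (transpose A *v v) = transpose A *v v" by (rule Dv)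
    then have "?S *v v = A *v (transpose A *v v)"
      by (simp only: flip: matrix_vector_mul_assoc)
    then show "?S *v v = v" by (simp add: matrix_vector_mul_assoc AA del: transpose_matrix_vector)
  qed
qed

text \<open>One reflection takes \<open>w\<close> to \<open>u\<close>; a second one moves the image
  of \<open>p\<close> to \<open>q\<close> and fixes \<open>u\<close>, because both of these vectors
  are orthogonal to \<open>u\<close>. If the determinant is -1, a reflection along some
  \<open>z\<close> orthogonal to \<open>u\<close> and \<open>q\<close> corrects it; three dimensions
  provide such a \<open>z\<close>.\<close>

lemma rotation_of_orthogonal_pair:
  fixes w p u q :: "real^'n"
  assumes "CARD('n) \<ge> 3" "norm w = norm u" "norm p = norm q" "w \<bullet> p = 0" "u \<bullet> q = 0"
  obtains Q where "orthogonal_matrix Q" "det Q = 1" "Q *v w = u" "Q *v p = q"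
proof -
  define f where "f = reflection (w - u)"
  define f' where "f' = reflection (f p - q)"
  have f: "orthogonal_transformation f" "orthogonal_transformation f'"
    by (simp_all add: f_def f'_def orthogonal_transformation_reflection)
  have fw: "f w = u" using assms by (simp add: f_def reflection_swap)
  have "u \<bullet> f p = 0"
    using f(1) assms(4) fw by (metis orthogonal_transformation_def)
  then have "f' u = u"
    using assms(5) unfolding f'_def
    by (intro reflection_fixes) (simp add: inner_diff_left inner_diff_right inner_commute [of _ u])
  moreover have "f' (f p) = q"
    using f assms(3) by (auto simp: f'_def orthogonal_transformation_norm intro!: reflection_swap)
  ultimately have comp: "(f' \<circ> f) w = u" "(f' \<circ> f) p = q" by (auto simp: fw)
  have orth: "orthogonal_transformation (f' \<circ> f)"
    using f by (intro orthogonal_transformation_compose)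
  define Q where "Q = matrix (f' \<circ> f)"
  have Q: "orthogonal_matrix Q" "\<And>v. Q *v v = (f' \<circ> f) v"
    using orth by (auto simp: Q_def orthogonal_transformation_matrix)
  show thesis
  proof (cases "det Q = 1")
    case True
    then show thesis using that Q comp by metis
  next
    case False
    then have "det Q = -1" using det_orthogonal_matrix [OF Q(1)] by auto
    have "dim {u, q} < DIM(real^'n)"
    proof -
      have "dim {u, q} \<le> card {u, q}" by (rule dim_le_card') simp
      also have "\<dots> \<le> 2" by (simp add: card_insert_if)
      finally show ?thesis using assms(1) by simp
    qed
    then obtain z where z: "z \<noteq> 0" "\<And>y. y \<in> span {u, q} \<Longrightarrow> orthogonal z y"
      using orthogonal_to_subspace_exists by metis
    then have "z \<bullet> u = 0" "z \<bullet> q = 0"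
      by (auto simp: orthogonal_def span_base)
    obtain S where S: "orthogonal_matrix S" "det S = -1" "\<And>v. z \<bullet> v = 0 \<Longrightarrow> S *v v = v"
      using exists_rotoinversion_fixing [OF z(1)] by metis
    show thesis
    proof (rule that [of "S ** Q"])
      show "orthogonal_matrix (S ** Q)" using S Q by (intro orthogonal_matrix_mul)
      show "det (S ** Q) = 1" using S \<open>det Q = -1\<close> by (simp add: det_mul)
      show "(S ** Q) *v w = u" "(S ** Q) *v p = q"
        using comp S(3) \<open>z \<bullet> u = 0\<close> \<open>z \<bullet> q = 0\<close> by (simp_all add: Q flip: matrix_vector_mul_assoc)
    qed
  qed
qed

section \<open>Rank one matrices and non-scalar matrices\<close>

definition outer :: "real^'n \<Rightarrow> real^'n \<Rightarrow> real^'n^'n" where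
  "outer a b = (\<chi> i j. a $ i * b $ j)"

lemma outer_mult_vec: "outer a b *v v = (b \<bullet> v) *\<^sub>R a"
  by (simp add: outer_def matrix_vector_mult_def vec_eq_iff inner_vec_def sum_distrib_left mult_ac)

lemma mult_outer: "A ** outer a b = outer (A *v a) b"
  by (simp add: matrix_eq outer_mult_vec matrix_vector_mult_scaleR flip: matrix_vector_mul_assoc)

lemma outer_mult_transpose: "outer a b ** transpose A = outer a (A *v b)"
  by (simp add: matrix_eq outer_mult_vec flip: matrix_vector_mul_assoc)
    (metis dot_lmul_matrix inner_commute)

lemma trace_outer: "trace (outer a b) = a \<bullet> b"
  by (simp add: trace_def outer_def inner_vec_def)

lemma scalar_if_all_eigenvectors:
  fixes A :: "real^'n^'n"
  assumes "\<And>v. \<exists>c. A *v v = c *\<^sub>R v"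
  shows "\<exists>c. A = c *\<^sub>R mat 1"
proof -
  have "\<exists>c. A *v axis i 1 = c *\<^sub>R axis i 1" for i using assms by blast
  then obtain c where c: "\<And>i. A *v axis i 1 = c i *\<^sub>R axis i 1" by metis
  have "c i = c j" for i j
  proof (cases "i = j")
    case False
    obtain d where "A *v (axis i 1 + axis j 1) = d *\<^sub>R (axis i 1 + axis j 1)" using assms by blast
    then have "c i *\<^sub>R axis i 1 + c j *\<^sub>R axis j (1::real) = d *\<^sub>R axis i 1 + d *\<^sub>R axis j 1"
      by (simp add: matrix_vector_right_distrib c scaleR_right_distrib)
    then have "\<And>k. c i * axis i 1 $ k + c j * axis j (1::real) $ k = d * axis i 1 $ k + d * axis j 1 $ k"
      by (simp add: vec_eq_iff)
    from this [of i] this [of j] show ?thesis using False by (simp add: axis_def)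
  qed simp
  then obtain d where d: "\<And>i. c i = d" by blast
  have "A = d *\<^sub>R mat 1"
  proof -
    have "A $ i $ j = (d *\<^sub>R axis j 1) $ i" for i j
      using matrix_vector_mult_basis [of A j] by (simp add: c d column_def vec_eq_iff)
    then show ?thesis by (auto simp: vec_eq_iff mat_def axis_def)
  qed
  then show ?thesis by blast
qed

lemma sl_not_scalar:
  fixes x :: "real^'n^'n"
  assumes "x \<in> sl" "x \<noteq> 0"
  obtains v where "\<And>c. x *v v \<noteq> c *\<^sub>R v"
proof -
  have "x \<noteq> c *\<^sub>R mat 1" for c
    using assms by (auto simp: sl_def trace_linear_simps trace_I)
  then show thesis using scalar_if_all_eigenvectors [of x] that by blast
qed

lemma continuous_on_det [continuous_intros]:
  fixes f :: "'a::topological_space \<Rightarrow> real^'n^'n"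
  assumes "continuous_on S f"
  shows "continuous_on S (\<lambda>x. det (f x))"
  unfolding det_def using assms by (intro continuous_intros)

text \<open>The matrix multiplies the range of \<open>P\<close> by \<open>s\<close> and fixes its
  kernel, so replacing \<open>s\<close> by 1 / s inverts it. The determinant has no zero for
  positive parameters and equals 1 at parameter 1, hence by connectedness it stays positive.\<close>

lemma det_pos_rank_one_perturbation:
  fixes P :: "real^'n^'n"
  assumes "P ** P = P" "s > 0"
  shows "det (mat 1 + (s - 1) *\<^sub>R P) > 0"
    and "matrix_inv (mat 1 + (s - 1) *\<^sub>R P) = mat 1 + (1 / s - 1) *\<^sub>R P"
proof -
  define D where "D t = mat 1 + (t - 1) *\<^sub>R P" for t
  have inv: "D t ** (mat 1 + (1 / t - 1) *\<^sub>R P) = mat 1" if "t > 0" for t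
  proof -
    have "(mat 1 + b *\<^sub>R P) ** (mat 1 + a *\<^sub>R P) = mat 1 + (a + b + b * a) *\<^sub>R P" for a b
      by (simp add: matrix_ring_simps assms(1) scaleR_add_left scaleR_add_right)
    then have "D t ** (mat 1 + (1 / t - 1) *\<^sub>R P) =
        mat 1 + ((1 / t - 1) + (t - 1) + (t - 1) * (1 / t - 1)) *\<^sub>R P"
      unfolding D_def by blast
    also have "(1 / t - 1) + (t - 1) + (t - 1) * (1 / t - 1) = 0"
      using that by (simp add: field_simps)
    finally show ?thesis by simp
  qed
  have nz: "det (D t) \<noteq> 0" if "t > 0" for t
    using inv [OF that] by (metis det_I det_mul mult_zero_left zero_neq_one)
  have "connected ((\<lambda>t. det (D t)) ` {0<..})"
    unfolding D_def by (intro connected_continuous_image continuous_intros convex_connected) auto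
  moreover have "0 \<notin> (\<lambda>t. det (D t)) ` {0<..}" using nz by auto
  moreover have "1 \<in> (\<lambda>t. det (D t)) ` {0<..}"
    by (intro image_eqI [of _ _ 1]) (auto simp: D_def)
  ultimately have "\<not> det (D s) < 0"
    using assms(2) unfolding connected_iff_interval
    by (meson greaterThan_iff imageI less_imp_le zero_le_one)
  then show "det (mat 1 + (s - 1) *\<^sub>R P) > 0"
    using nz [OF assms(2)] by (simp add: D_def)
  show "matrix_inv (mat 1 + (s - 1) *\<^sub>R P) = mat 1 + (1 / s - 1) *\<^sub>R P"
    using inv [OF assms(2)] by (intro matrix_inv_unique) (simp add: D_def)
qed

text \<open>With \<open>P = v p\<^sup>T\<close> a projection and \<open>p \<bullet> x v = 0\<close>, the matrices \<open>s (1 - P + s P) x (1 - P + s P)\<^sup>-\<^sup>1\<close>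
  tend to \<open>(x v) p\<^sup>T\<close> as \<open>s\<close> decreases to \<open>0\<close>. A rotation \<open>Q\<close> turns the orthogonal pair
  \<open>(x v, p)\<close> into a pair \<open>(u, q)\<close> with \<open>q \<bullet> \<beta> u < 0\<close>; this needs dimension at least three.\<close>

lemma exists_orbit_trace_negative:
  fixes x \<beta> :: "real^'n^'n"
  assumes n: "CARD('n) \<ge> 3" and x: "x \<in> sl" "x \<noteq> 0" and \<beta>: "\<beta> \<in> sl" "\<beta> \<noteq> 0"
  shows "\<exists>y\<in>adjoint_orbit x. trace (y ** \<beta>) < 0"
proof -
  obtain v where v: "\<And>c. x *v v \<noteq> c *\<^sub>R v" using sl_not_scalar [OF x] by blast
  obtain u where u: "\<And>c. \<beta> *v u \<noteq> c *\<^sub>R u" using sl_not_scalar [OF \<beta>] by blast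
  define w where "w = x *v v"
  \<comment> \<open>\<open>p\<close> is the part of \<open>v\<close> orthogonal to \<open>w\<close>,
    and \<open>q\<close> below is minus the part of \<open>\<beta> *v u\<close> orthogonal to
    \<open>u\<close>. Both are nonzero because \<open>v\<close> and \<open>u\<close> are not
    eigenvectors. This gives p \<bullet> v = p \<bullet> p, and q \<bullet> \<beta> u = - (q
    \<bullet> q) supplies the negative sign.\<close>
  define p where "p = v - ((v \<bullet> w) / (w \<bullet> w)) *\<^sub>R w"
  define q where "q = (((\<beta> *v u) \<bullet> u) / (u \<bullet> u)) *\<^sub>R u - \<beta> *v u"
  have w0: "w \<noteq> 0" using v [of 0] by (simp add: w_def)
  have u0: "u \<noteq> 0" using u [of 0] by auto
  have q0: "q \<noteq> 0" using u [of "((\<beta> *v u) \<bullet> u) / (u \<bullet> u)"] by (auto simp: q_def)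
  have p0: "p \<noteq> 0"
  proof
    define c where "c = (v \<bullet> w) / (w \<bullet> w)"
    assume "p = 0"
    then have vc: "v = c *\<^sub>R w" by (simp add: p_def c_def)
    then have "c \<noteq> 0" using w0 by (auto simp: w_def)
    then have "w = (1 / c) *\<^sub>R v" using vc by simp
    then show False using v by (simp add: w_def)
  qed
  have pw: "p \<bullet> w = 0" and qu: "q \<bullet> u = 0"
    using w0 u0 by (simp_all add: p_def q_def inner_diff_left)
  have "p \<bullet> p = p \<bullet> v - (v \<bullet> w) / (w \<bullet> w) * (p \<bullet> w)"
    by (subst (2) p_def) (simp add: inner_diff_right)
  then have pv: "p \<bullet> v = p \<bullet> p" using pw by simp
  have "q \<bullet> q = ((\<beta> *v u) \<bullet> u) / (u \<bullet> u) * (q \<bullet> u) - q \<bullet> (\<beta> *v u)"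
    by (subst (2) q_def) (simp add: inner_diff_right)
  then have q\<beta>: "q \<bullet> (\<beta> *v u) = - (q \<bullet> q)" using qu by simp
  define a where "a = norm w / norm u"
  define b where "b = norm p / norm q"
  have ab: "a > 0" "b > 0" using w0 u0 p0 q0 by (auto simp: a_def b_def)
  obtain Q where Q: "orthogonal_matrix Q" "det Q = 1" "Q *v w = a *\<^sub>R u" "Q *v p = b *\<^sub>R q"
    by (rule rotation_of_orthogonal_pair [OF n, of w "a *\<^sub>R u" p "b *\<^sub>R q"])
      (use w0 u0 p0 q0 pw qu in \<open>auto simp: a_def b_def inner_commute\<close>)
  define p' where "p' = (1 / (p \<bullet> p)) *\<^sub>R p"
  define P where "P = outer v p'"
  have p'v: "p' \<bullet> v = 1" and p'w: "p' \<bullet> w = 0"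
    using p0 pv pw by (simp_all add: p'_def)
  have P: "P ** P = P"
    by (simp add: P_def mult_outer outer_mult_vec p'v)
  have xP: "x ** P = outer w p'" by (simp add: P_def mult_outer w_def)
  have PxP: "outer (P *v w) p' = 0"
    by (simp add: P_def outer_mult_vec p'w) (simp add: outer_def vec_eq_iff)
  \<comment> \<open>For s > 0 this is s tr(y \<beta>) with y the conjugate of \<open>x\<close> by
    \<open>Q ** D\<close>. Multiplying the inverse of \<open>D\<close> by \<open>s\<close> removes
    its pole, so \<open>F\<close> is polynomial and can be evaluated at 0.\<close>
  define F where "F s = trace (Q ** ((mat 1 - P + s *\<^sub>R P) ** x ** (s *\<^sub>R (mat 1 - P) + P)) ** transpose Q ** \<beta>)" for s
  have "F 0 = trace (Q ** (x ** P - P ** (x ** P)) ** transpose Q ** \<beta>)"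
    by (simp add: F_def matrix_ring_simps)
  also have "\<dots> = trace (outer (a *\<^sub>R u) (Q *v p') ** \<beta>)"
    by (simp add: xP PxP mult_outer outer_mult_transpose Q)
  also have "\<dots> = trace (\<beta> ** outer (a *\<^sub>R u) (Q *v p'))" by (rule trace_mul_sym)
  also have "Q *v p' = (b / (p \<bullet> p)) *\<^sub>R q"
    by (simp add: p'_def matrix_vector_mult_scaleR Q)
  also have "trace (\<beta> ** outer (a *\<^sub>R u) ((b / (p \<bullet> p)) *\<^sub>R q)) = a * (b / (p \<bullet> p)) * (q \<bullet> (\<beta> *v u))"
    by (simp add: mult_outer trace_outer matrix_vector_mult_scaleR inner_commute)
  also have "\<dots> < 0"
    using ab p0 q0 by (simp add: q\<beta> mult_pos_pos)
  finally have F0: "F 0 < 0" .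
  have "continuous_on UNIV F"
    unfolding F_def by (intro continuous_intros)
  then have "(F \<longlongrightarrow> F 0) (at_right 0)"
    by (metis UNIV_I continuous_on_def tendsto_within_subset subset_UNIV)
  then have "eventually (\<lambda>s. F s < 0) (at_right 0)" using F0 by (rule order_tendstoD)
  then obtain s where s: "s > 0" "F s < 0"
    by (metis (mono_tags, lifting) eventually_at_right_field dense)
  define D where "D = mat 1 + (s - 1) *\<^sub>R P"
  have D: "det D > 0" "matrix_inv D = mat 1 + (1 / s - 1) *\<^sub>R P"
    unfolding D_def using det_pos_rank_one_perturbation [OF P s(1)] by auto
  have Qinv: "matrix_inv Q = transpose Q"
    using Q by (intro matrix_inv_unique) (auto simp: orthogonal_matrix_def)
  have D1: "D = mat 1 - P + s *\<^sub>R P" by (simp add: D_def algebra_simps)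
  have D2: "s *\<^sub>R matrix_inv D = s *\<^sub>R (mat 1 - P) + P" using s by (simp add: D algebra_simps)
  let ?y = "(Q ** D) ** x ** matrix_inv (Q ** D)"
  have "?y \<in> adjoint_orbit x"
    unfolding adjoint_orbit_iff using Q D by (intro exI [of _ "Q ** D"]) (simp add: det_mul)
  moreover have "s * trace (?y ** \<beta>) = F s"
  proof -
    have "s *\<^sub>R (?y ** \<beta>) = Q ** (D ** x ** (s *\<^sub>R matrix_inv D)) ** transpose Q ** \<beta>"
      using Q D by (simp add: conj_mult Qinv matrix_ring_simps)
    then show ?thesis
      unfolding F_def D1 [symmetric] D2 [symmetric]
      using linear_scale [OF linear_trace, of s "?y ** \<beta>"] by simp
  qed
  ultimately show ?thesis using s by (metis mult_less_0_iff not_less_iff_gr_or_eq)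
qed

section \<open>Symplectic bases and the Pfaffian\<close>

text \<open>The Gram matrix of a symplectic basis in the interleaved order, partners at 2 i and 2 i
  + 1. This order matches the arguments of \<open>wedge_power\<close>, so the identity permutation
  contributes 1.\<close>

definition symplectic_unit :: "nat \<Rightarrow> nat \<Rightarrow> real" where
  "symplectic_unit i j =
     (if i div 2 \<noteq> j div 2 then 0 else if i < j then 1 else if j < i then -1 else 0)"

text \<open>Symplectic Gram-Schmidt: split off a hyperbolic plane spanned by \<open>a\<close> and
  \<open>b\<close>, then continue in its orthogonal complement with respect to \<omega>, on which
  the form is again nondegenerate.\<close>

lemma symplectic_basis_exists:
  fixes \<omega> :: "'a::euclidean_space \<Rightarrow> 'a \<Rightarrow> real"
  assumes "bilinear \<omega>" and alt: "\<And>v w. \<omega> v w = - \<omega> w v"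
    and "subspace W" "\<And>v. v \<in> W \<Longrightarrow> (\<And>w. w \<in> W \<Longrightarrow> \<omega> v w = 0) \<Longrightarrow> v = 0"
  shows "\<exists>d e. (\<forall>i<2 * d. e i \<in> W) \<and>
    (\<forall>i<2 * d. \<forall>j<2 * d. \<omega> (e i) (e j) = symplectic_unit i j) \<and> W \<subseteq> span (e ` {..<2 * d})"
  using assms(3,4)
proof (induction "dim W" arbitrary: W rule: less_induct)
  case less
  note bil = bilinear_ladd [OF assms(1)] bilinear_radd [OF assms(1)] bilinear_lmul [OF assms(1)]
    bilinear_rmul [OF assms(1)] bilinear_lsub [OF assms(1)] bilinear_rsub [OF assms(1)]
    bilinear_lzero [OF assms(1)] bilinear_rzero [OF assms(1)]
  have self: "\<omega> v v = 0" for v using alt [of v v] by simp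
  show ?case
  proof (cases "W \<subseteq> {0}")
    case True
    then show ?thesis by (intro exI [of _ 0]) auto
  next
    case False
    then obtain a where a: "a \<in> W" "a \<noteq> 0" by auto
    then obtain b0 where b0: "b0 \<in> W" "\<omega> a b0 \<noteq> 0" using less.prems by blast
    define b where "b = (1 / \<omega> a b0) *\<^sub>R b0"
    have b: "b \<in> W" "\<omega> a b = 1" "\<omega> b a = -1"
      using b0 less.prems(1) alt [of b a] by (auto simp: b_def bil subspace_scale)
    define W' where "W' = {w\<in>W. \<omega> a w = 0 \<and> \<omega> b w = 0}"
    have W': "subspace W'"
      using less.prems(1) by (auto simp: W'_def subspace_def bil)
    have "a \<notin> W'" using b by (simp add: W'_def)
    then have "W' \<subset> W" using a by (auto simp: W'_def)
    then have dim: "dim W' < dim W"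
      using W' less.prems(1) by (intro dim_psubset) (metis span_eq_iff)
    \<comment> \<open>The projection onto \<open>W'\<close> along the plane spanned by
      \<open>a\<close> and \<open>b\<close>.\<close>
    define \<pi> where "\<pi> w = w - \<omega> w b *\<^sub>R a + \<omega> w a *\<^sub>R b" for w
    have \<pi>: "\<pi> w \<in> W'" if "w \<in> W" for w
      using that a b less.prems(1) alt [of a w] alt [of b w]
      by (auto simp: W'_def \<pi>_def bil self intro!: subspace_add subspace_diff subspace_scale)
    have nondeg: "v = 0" if v: "v \<in> W'" "\<And>w. w \<in> W' \<Longrightarrow> \<omega> v w = 0" for v
    proof (rule less.prems(2))
      show "v \<in> W" using v by (simp add: W'_def)
      fix w assume "w \<in> W"
      then have "\<omega> v (\<pi> w) = 0" using \<pi> v by blast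
      moreover have "\<omega> v a = 0" "\<omega> v b = 0"
        using v(1) alt [of v a] alt [of v b] by (auto simp: W'_def)
      ultimately show "\<omega> v w = 0" by (simp add: \<pi>_def bil)
    qed
    obtain d e' where e': "\<And>i. i < 2 * d \<Longrightarrow> e' i \<in> W'"
      "\<And>i j. i < 2 * d \<Longrightarrow> j < 2 * d \<Longrightarrow> \<omega> (e' i) (e' j) = symplectic_unit i j"
      "W' \<subseteq> span (e' ` {..<2 * d})"
      using less.hyps [OF dim W' nondeg] by metis
    define e where "e i = (if i < 2 * d then e' i else if i = 2 * d then a else b)" for i
    have eW: "e i \<in> W" for i using e'(1) a b by (auto simp: e_def W'_def)
    have ee: "\<omega> (e i) (e j) = symplectic_unit i j" if "i < 2 * Suc d" "j < 2 * Suc d" for i j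
    proof -
      have cases: "k < 2 * d \<or> k = 2 * d \<or> k = Suc (2 * d)" if "k < 2 * Suc d" for k
        using that by auto
      have ab: "\<omega> a (e' k) = 0" "\<omega> b (e' k) = 0" "\<omega> (e' k) a = 0" "\<omega> (e' k) b = 0" if "k < 2 * d" for k
        using e'(1) [OF that] alt [of "e' k" a] alt [of "e' k" b] by (auto simp: W'_def)
      have "k div 2 < d" if "k < 2 * d" for k using that by auto
      then show ?thesis
        using cases [OF that(1)] cases [OF that(2)] ab e'(2) self b
        by (auto simp: e_def symplectic_unit_def)
    qed
    have "w \<in> span (e ` {..<2 * Suc d})" if "w \<in> W" for w
    proof -
      have "e' ` {..<2 * d} \<subseteq> e ` {..<2 * Suc d}" by (force simp: e_def)
      then have "\<pi> w \<in> span (e ` {..<2 * Suc d})"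
        using \<pi> [OF that] e'(3) span_mono by blast
      moreover have "a = e (2 * d)" "b = e (Suc (2 * d))" by (simp_all add: e_def)
      then have "a \<in> span (e ` {..<2 * Suc d})" "b \<in> span (e ` {..<2 * Suc d})"
        by (auto intro!: span_base imageI)
      ultimately have "\<pi> w + \<omega> w b *\<^sub>R a - \<omega> w a *\<^sub>R b \<in> span (e ` {..<2 * Suc d})"
        by (intro span_add span_diff span_scale)
      then show ?thesis by (simp add: \<pi>_def)
    qed
    then show ?thesis using eW ee by (intro exI [of _ "Suc d"] exI [of _ e]) blast
  qed
qed

text \<open>Pairing a linear relation with the partner \<open>e l\<close> of \<open>e k\<close>
  isolates the coefficient of \<open>e k\<close>.\<close>

lemma symplectic_basis_independent:
  fixes \<omega> :: "'a::euclidean_space \<Rightarrow> 'a \<Rightarrow> real"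
  assumes "bilinear \<omega>"
    and "\<And>i j. i < 2 * d \<Longrightarrow> j < 2 * d \<Longrightarrow> \<omega> (e i) (e j) = symplectic_unit i j"
    and "(\<Sum>i<2 * d. c i *\<^sub>R e i) = 0" "k < 2 * d"
  shows "c k = 0"
proof -
  define l where "l = (if even k then Suc k else k - 1)"
  have l: "l < 2 * d" "l \<noteq> k" "l div 2 = k div 2"
    using assms(4) by (auto simp: l_def elim!: evenE oddE)
  have only: "symplectic_unit i l = (if i = k then symplectic_unit k l else 0)" for i
    by (auto simp: symplectic_unit_def l_def elim!: evenE oddE)
  have "0 = \<omega> (\<Sum>i<2 * d. c i *\<^sub>R e i) (e l)"
    by (simp add: assms(3) bilinear_lzero [OF assms(1)])
  also have "\<dots> = (\<Sum>i<2 * d. c i * \<omega> (e i) (e l))"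
  proof -
    have lin: "linear (\<lambda>v. \<omega> v (e l))" using assms(1) by (simp add: bilinear_def)
    show ?thesis by (simp add: linear_sum [OF lin] linear_scale [OF lin])
  qed
  also have "\<dots> = (\<Sum>i<2 * d. if i = k then c k * symplectic_unit k l else 0)"
  proof (rule sum.cong [OF refl])
    fix i assume "i \<in> {..<2 * d}"
    then have "\<omega> (e i) (e l) = symplectic_unit i l" using assms(2) l(1) by simp
    then show "c i * \<omega> (e i) (e l) = (if i = k then c k * symplectic_unit k l else 0)"
      using only [of i] by (cases "i = k") simp_all
  qed
  also have "\<dots> = c k * symplectic_unit k l" using assms(4) by simp
  finally show ?thesis using l by (auto simp: symplectic_unit_def split: if_splits)
qed

text \<open>The contribution of \<open>p\<close> to the top power on a symplectic basis. Summed over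
  all permutations it gives 2^d d! times the Pfaffian of \<open>symplectic_unit\<close>.\<close>

definition pfaffian_term :: "nat \<Rightarrow> (nat \<Rightarrow> nat) \<Rightarrow> real" where
  "pfaffian_term d p = of_int (sign p) * (\<Prod>i<d. symplectic_unit (p (2 * i)) (p (2 * i + 1)))"

text \<open>A nonzero term belongs to a permutation that preserves the partition into pairs
  \<open>{2 i, 2 i + 1}\<close>. Composing it with a swap of two pairs or with a swap inside one pair leaves the
  term unchanged, which reduces to a permutation fixing the last pair.\<close>

lemma pfaffian_term_nonneg:
  assumes "p permutes {..<2 * d}"
  shows "pfaffian_term d p \<ge> 0"
  using assms
proof (induction d arbitrary: p)
  case 0
  then show ?case by (simp add: pfaffian_term_def)
next
  case (Suc d)
  let ?S = "{..<2 * Suc d}"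
  have perm: "permutation p" if "p permutes ?S" for p
    using that permutation_permutes by blast
  have fixed: "pfaffian_term (Suc d) p \<ge> 0"
    if p: "p permutes ?S" "p (2 * d) = 2 * d" "p (2 * d + 1) = 2 * d + 1" for p
  proof -
    have "p permutes {..<2 * d}"
    proof (rule permutes_superset [OF p(1)])
      fix i assume "i \<in> ?S - {..<2 * d}"
      then have "i = 2 * d \<or> i = 2 * d + 1" by auto
      then show "p i = i" using p by auto
    qed
    then have "pfaffian_term d p \<ge> 0" by (rule Suc.IH)
    moreover have "symplectic_unit (2 * d) (2 * d + 1) = 1" by (simp add: symplectic_unit_def)
    ultimately show ?thesis using p(2,3) by (simp add: pfaffian_term_def)
  qed
  have last: "pfaffian_term (Suc d) p \<ge> 0"
    if p: "p permutes ?S" and or: "p (2 * d) = 2 * d \<or> p (2 * d + 1) = 2 * d" for p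
  proof (cases "symplectic_unit (p (2 * d)) (p (2 * d + 1)) = 0")
    case True
    then show ?thesis by (simp add: pfaffian_term_def)
  next
    case False
    then have dv: "p (2 * d) div 2 = p (2 * d + 1) div 2" "p (2 * d) \<noteq> p (2 * d + 1)"
      by (auto simp: symplectic_unit_def split: if_splits)
    have second: "m = 2 * d + 1" if "m div 2 = d" "m \<noteq> 2 * d" for m :: nat
      using that by presburger
    from or show ?thesis
    proof
      assume "p (2 * d) = 2 * d"
      then show ?thesis using fixed p dv second [of "p (2 * d + 1)"] by simp
    next
      assume p1: "p (2 * d + 1) = 2 * d"
      then have p0: "p (2 * d) = 2 * d + 1" using dv second [of "p (2 * d)"] by simp
      let ?t = "Transposition.transpose (2 * d) (2 * d + 1)"
      let ?p = "p \<circ> ?t"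
      have t: "?t permutes ?S" by (rule permutes_swap_id) auto
      have "pfaffian_term (Suc d) ?p \<ge> 0"
        by (rule fixed) (use permutes_compose [OF t p] p0 p1 in auto)
      moreover have "pfaffian_term (Suc d) ?p = pfaffian_term (Suc d) p"
      proof -
        have "sign ?p = - sign p"
          using perm [OF p] perm [OF t] by (simp add: sign_compose sign_swap_id)
        moreover have "?t (2 * i) = 2 * i" "?t (2 * i + 1) = 2 * i + 1" if "i < d" for i
          using that by (auto simp: Transposition.transpose_def)
        then have "(\<Prod>i<d. symplectic_unit (?p (2 * i)) (?p (2 * i + 1))) =
            (\<Prod>i<d. symplectic_unit (p (2 * i)) (p (2 * i + 1)))"
          by (intro prod.cong) auto
        moreover have "symplectic_unit (2 * d) (2 * d + 1) = - symplectic_unit (2 * d + 1) (2 * d)"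
          by (simp add: symplectic_unit_def)
        ultimately show ?thesis using p0 p1 by (simp add: pfaffian_term_def)
      qed
      ultimately show ?thesis by simp
    qed
  qed
  have p: "p permutes ?S" by fact
  have "2 * d \<in> p ` ?S" unfolding permutes_image [OF p] by simp
  then obtain a where a: "a < 2 * Suc d" "p a = 2 * d" by force
  define i where "i = a div 2"
  have i: "i < Suc d" using a by (auto simp: i_def)
  define \<sigma> where "\<sigma> = Transposition.transpose i d"
  \<comment> \<open>\<open>q\<close> exchanges the pair containing \<open>a\<close> with the last
    pair. It is even, being either the identity (if i = d) or a product of two transpositions, and
    it merely reorders the factors of the product by \<sigma>.\<close>
  define q where "q = Transposition.transpose (2 * i) (2 * d) \<circ> Transposition.transpose (2 * i + 1) (2 * d + 1)"
  have q: "q (2 * j) = 2 * \<sigma> j" "q (2 * j + 1) = 2 * \<sigma> j + 1" for j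
  proof -
    have odd: "2 * j + 1 \<noteq> 2 * k" "2 * k \<noteq> 2 * j + 1" for j k :: nat by presburger+
    show "q (2 * j) = 2 * \<sigma> j" "q (2 * j + 1) = 2 * \<sigma> j + 1"
      using odd [of _ i] odd [of _ d] odd [of i] odd [of d]
      by (auto simp: q_def \<sigma>_def Transposition.transpose_def)
  qed
  have qS: "q permutes ?S"
    unfolding q_def using i by (intro permutes_compose permutes_swap_id) auto
  have "sign q = 1"
    unfolding q_def using i by (subst sign_compose) (auto simp: sign_swap_id permutation_swap_id)
  then have sgn: "sign (p \<circ> q) = sign p"
    using perm [OF p] perm [OF qS] by (simp add: sign_compose)
  have \<sigma>: "\<sigma> permutes {..<Suc d}"
    unfolding \<sigma>_def using i by (intro permutes_swap_id) auto
  have "(\<Prod>j<Suc d. symplectic_unit ((p \<circ> q) (2 * j)) ((p \<circ> q) (2 * j + 1))) =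
      (\<Prod>j<Suc d. (\<lambda>j. symplectic_unit (p (2 * j)) (p (2 * j + 1))) (\<sigma> j))"
    by (simp only: comp_def q)
  also have "\<dots> = (\<Prod>j<Suc d. symplectic_unit (p (2 * j)) (p (2 * j + 1)))"
    using prod.permute [OF \<sigma>, of "\<lambda>j. symplectic_unit (p (2 * j)) (p (2 * j + 1))"] by (simp add: comp_def)
  finally have "pfaffian_term (Suc d) (p \<circ> q) = pfaffian_term (Suc d) p"
    by (simp only: pfaffian_term_def sgn)
  moreover have "pfaffian_term (Suc d) (p \<circ> q) \<ge> 0"
  proof (rule last)
    show "p \<circ> q permutes ?S" by (rule permutes_compose [OF qS p])
    have "a = 2 * i \<or> a = 2 * i + 1" unfolding i_def by presburger
    then show "(p \<circ> q) (2 * d) = 2 * d \<or> (p \<circ> q) (2 * d + 1) = 2 * d"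
      unfolding comp_def q using a by (auto simp: \<sigma>_def)
  qed
  ultimately show ?case by simp
qed

text \<open>The exact value is d!, but a lower bound on volume only asks for positivity: no term is
  negative and the identity contributes 1.\<close>

lemma wedge_power_symplectic_basis_pos:
  assumes "\<And>i j. i < 2 * d \<Longrightarrow> j < 2 * d \<Longrightarrow> \<omega> (e i) (e j) = symplectic_unit i j"
  shows "wedge_power d \<omega> e > 0"
proof -
  let ?P = "{p. p permutes {..<2 * d}}"
  have "of_int (sign p) * (\<Prod>i<d. \<omega> (e (p (2 * i))) (e (p (2 * i + 1)))) = pfaffian_term d p"
    if "p \<in> ?P" for p
    unfolding pfaffian_term_def
    using that permutes_in_image [of p "{..<2 * d}"]
    by (intro arg_cong2 [of _ _ _ _ "(*)"] refl prod.cong assms) auto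
  then have "wedge_power d \<omega> e = (\<Sum>p\<in>?P. pfaffian_term d p) / 2 ^ d"
    unfolding wedge_power_def by (intro arg_cong2 [of _ _ _ _ "(/)"] sum.cong) auto
  moreover have "pfaffian_term d id \<le> (\<Sum>p\<in>?P. pfaffian_term d p)"
    by (rule member_le_sum) (use permutes_id [of "{..<2 * d}"] in \<open>auto simp: pfaffian_term_nonneg finite_permutations id_def\<close>)
  moreover have "pfaffian_term d id = 1"
    by (simp add: pfaffian_term_def symplectic_unit_def sign_id)
  ultimately show ?thesis by simp
qed

section \<open>A slice to the centralizer\<close>

lemma continuous_on_matrix_inv [continuous_intros]:
  fixes f :: "'a::topological_space \<Rightarrow> real^'n^'n"
  assumes "continuous_on S f" "\<And>x. x \<in> S \<Longrightarrow> det (f x) \<noteq> 0"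
  shows "continuous_on S (\<lambda>x. matrix_inv (f x))"
proof -
  have eq: "matrix_inv A = (\<chi> k l. det (\<chi> i j. if j = k then axis l 1 $ i else A $ i $ j) / det A)"
    if "det A \<noteq> 0" for A :: "real^'n^'n"
  proof -
    have "matrix_inv A *v axis l 1 =
        (\<chi> k. det (\<chi> i j. if j = k then axis l 1 $ i else A $ i $ j) / det A)" for l
      by (subst cramer [OF that, symmetric]) (simp add: matrix_vector_mul_assoc matrix_inv that)
    then show ?thesis
      by (simp add: vec_eq_iff matrix_vector_mult_basis column_def)
  qed
  have "continuous_on S (\<lambda>x. if j = k then c else f x $ i $ j)" for i j k c
    using assms(1) by (cases "j = k") (auto intro!: continuous_intros)
  then have "continuous_on S (\<lambda>x. (\<chi> k l. det (\<chi> i j. if j = k then axis l 1 $ i else f x $ i $ j) / det (f x))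
      :: real^'n^'n)"
    using assms by (intro continuous_intros) auto
  then show ?thesis by (rule continuous_on_eq) (simp add: eq assms)
qed

lemma has_vector_derivative_quotientI:
  assumes "((\<lambda>t. (f t - f s) /\<^sub>R (t - s)) \<longlongrightarrow> D) (at s)"
  shows "(f has_vector_derivative D) (at s)"
proof -
  have "((\<lambda>t. norm ((f t - f s) /\<^sub>R (t - s) - D)) \<longlongrightarrow> 0) (at s)"
    using assms by (simp add: LIM_zero_iff tendsto_norm_zero_iff)
  moreover have "norm ((f t - f s) /\<^sub>R (t - s) - D) = norm (f t - f s - (t - s) *\<^sub>R D) / norm (t - s)"
    if "t \<noteq> s" for t
  proof -
    have "(f t - f s) /\<^sub>R (t - s) - D = (f t - f s - (t - s) *\<^sub>R D) /\<^sub>R (t - s)"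
      using that by (simp add: scaleR_diff_right)
    then show ?thesis by (simp add: divide_inverse mult.commute)
  qed
  then have "eventually (\<lambda>t. norm ((f t - f s) /\<^sub>R (t - s) - D) =
      norm (f t - f s - (t - s) *\<^sub>R D) / norm (t - s)) (at s)"
    by (simp add: eventually_at_filter)
  ultimately show ?thesis
    unfolding has_vector_derivative_def has_derivative_iff_norm
    by (auto intro: bounded_linear_scaleR_left Lim_transform_eventually)
qed

text \<open>Let B t be the point on the line and h t = B t y (B t)^-1. From h t B t = B t y the
  difference quotient is exactly (E y - h s E) (B t)^-1, so continuity of the inverse suffices and
  the inverse is never differentiated.\<close>

lemma conj_line_has_vector_derivative:
  fixes A E y :: "real^'n^'n"
  assumes "det A \<noteq> 0"
  shows "((\<lambda>t. (A + (t - s) *\<^sub>R E) ** y ** matrix_inv (A + (t - s) *\<^sub>R E)) has_vector_derivative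
    bracket (E ** matrix_inv A) (A ** y ** matrix_inv A)) (at s)"
proof (rule has_vector_derivative_quotientI)
  define B where "B t = A + (t - s) *\<^sub>R E" for t
  define h where "h t = B t ** y ** matrix_inv (B t)" for t
  have Bs: "B s = A" by (simp add: B_def)
  have contB: "continuous_on UNIV B" unfolding B_def by (intro continuous_intros)
  define T where "T = {t. det (B t) \<noteq> 0}"
  have T: "open T" "s \<in> T"
    unfolding T_def using assms contB
    by (auto simp: Bs intro!: open_Collect_neq continuous_intros)
  have quot: "(h t - h s) /\<^sub>R (t - s) = (E ** y - h s ** E) ** matrix_inv (B t)" if "t \<in> T" "t \<noteq> s" for t
  proof -
    have det: "det (B t) \<noteq> 0" using that by (simp add: T_def)
    have "(h t - h s) ** B t = B t ** y - h s ** A - (t - s) *\<^sub>R (h s ** E)"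
      by (simp add: h_def matrix_ring_simps matrix_inv_cancel det) (simp add: B_def matrix_ring_simps)
    also have "h s ** A = A ** y"
      using assms by (simp add: h_def Bs matrix_inv_cancel)
    also have "B t ** y - A ** y - (t - s) *\<^sub>R (h s ** E) = (t - s) *\<^sub>R (E ** y - h s ** E)"
      by (simp add: B_def matrix_ring_simps scaleR_diff_right)
    finally have "(h t - h s) ** B t ** matrix_inv (B t) = (t - s) *\<^sub>R (E ** y - h s ** E) ** matrix_inv (B t)"
      by simp
    then have "h t - h s = (t - s) *\<^sub>R ((E ** y - h s ** E) ** matrix_inv (B t))"
      by (simp add: matrix_inv_cancel det matmul.scaleR_left)
    then show ?thesis using that by simp
  qed
  have "continuous_on T (\<lambda>t. (E ** y - h s ** E) ** matrix_inv (B t))"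
    using contB by (intro continuous_intros) (auto simp: T_def intro: continuous_on_subset)
  then have "((\<lambda>t. (E ** y - h s ** E) ** matrix_inv (B t)) \<longlongrightarrow> (E ** y - h s ** E) ** matrix_inv (B s)) (at s)"
    using T by (simp add: continuous_on_eq_continuous_at isCont_def)
  moreover have "(E ** y - h s ** E) ** matrix_inv (B s) = bracket (E ** matrix_inv A) (A ** y ** matrix_inv A)"
    using assms by (simp add: h_def Bs bracket_def matrix_ring_simps matrix_inv_cancel)
  moreover have "eventually (\<lambda>t. (E ** y - h s ** E) ** matrix_inv (B t) = (h t - h s) /\<^sub>R (t - s)) (at s)"
    using eventually_at_topological T quot by (metis (mono_tags, lifting))
  ultimately show "((\<lambda>t. ((A + (t - s) *\<^sub>R E) ** y ** matrix_inv (A + (t - s) *\<^sub>R E) -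
      (A + (s - s) *\<^sub>R E) ** y ** matrix_inv (A + (s - s) *\<^sub>R E)) /\<^sub>R (t - s)) \<longlongrightarrow>
      bracket (E ** matrix_inv A) (A ** y ** matrix_inv A)) (at s)"
    unfolding h_def B_def by (auto intro: Lim_transform_eventually)
qed

lemma independent_family:
  fixes e :: "nat \<Rightarrow> 'a::euclidean_space"
  assumes "\<And>c k. (\<Sum>i<m. c i *\<^sub>R e i) = 0 \<Longrightarrow> k < m \<Longrightarrow> c k = 0"
  shows "inj_on e {..<m}" "independent (e ` {..<m})"
proof -
  show inj: "inj_on e {..<m}"
  proof (rule inj_onI, rule ccontr)
    fix i j assume ij: "i \<in> {..<m}" "j \<in> {..<m}" "e i = e j" "i \<noteq> j"
    let ?c = "\<lambda>k. (if k = i then 1 else 0) - (if k = j then 1 else 0) :: real"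
    have "(\<Sum>k<m. ?c k *\<^sub>R e k) = (\<Sum>k<m. (if k = i then e k else 0) - (if k = j then e k else 0))"
      by (rule sum.cong) auto
    also have "\<dots> = 0" using ij by (simp add: sum_subtractf)
    finally have "?c i = 0" using assms [of ?c i] ij(1) by simp
    then show False using ij by simp
  qed
  show "independent (e ` {..<m})"
  proof
    assume "dependent (e ` {..<m})"
    then obtain u where u: "\<exists>v\<in>e ` {..<m}. u v \<noteq> (0::real)" "(\<Sum>v\<in>e ` {..<m}. u v *\<^sub>R v) = 0"
      by (auto simp: dependent_finite)
    then have "(\<Sum>i<m. u (e i) *\<^sub>R e i) = 0" by (simp add: sum.reindex [OF inj])
    then have "u (e k) = 0" if "k < m" for k using assms [of "\<lambda>i. u (e i)"] that by blast
    then show False using u(1) by auto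
  qed
qed

text \<open>The form at \<open>g y g\<^sup>-\<^sup>1\<close>, pulled back along the differential
  \<open>X \<mapsto> [X g\<^sup>-\<^sup>1, g y g\<^sup>-\<^sup>1]\<close> of the conjugation map \<open>g \<mapsto> g y g\<^sup>-\<^sup>1\<close>.\<close>

definition kks_lift :: "real^'n^'n \<Rightarrow> real^'n^'n \<Rightarrow> real^'n^'n \<Rightarrow> real^'n^'n \<Rightarrow> real" where
  "kks_lift y g X Y = 2 * real CARD('n) * trace (y ** bracket (matrix_inv g ** X) (matrix_inv g ** Y))"

lemma matrix_inv_mat_1 [simp]: "matrix_inv (mat 1 :: real^'n^'n) = mat 1"
  by (rule matrix_inv_unique) simp

lemma bracket_simps:
  "bracket (A + B) C = bracket A C + bracket B C" "bracket A (B + C) = bracket A B + bracket A C"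
  "bracket (r *\<^sub>R A) B = r *\<^sub>R bracket A B" "bracket A (r *\<^sub>R B) = r *\<^sub>R bracket A (B :: real^'n^'n)"
  by (simp_all add: bracket_def matrix_ring_simps scaleR_diff_right)

lemma bilinear_kks_lift: "bilinear (kks_lift y g)"
  unfolding bilinear_def kks_lift_def
  by (auto intro!: linearI simp: matrix_ring_simps bracket_simps trace_linear_simps algebra_simps)

lemma kks_lift_alternating: "kks_lift y g X Y = - kks_lift y g Y X"
  unfolding kks_lift_def
  by (simp add: bracket_minus_comm [of "matrix_inv g ** X"] matrix_ring_simps trace_linear_simps)

lemma subspace_centralizer: "subspace {X. bracket X (y :: real^'n^'n) = 0}"
  by (auto simp: subspace_def bracket_simps) (simp add: bracket_def)

text \<open>Since tr(y [X, Y]) = tr([y, X] Y), the radical of the lifted form at the identity is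
  exactly the centralizer of \<open>y\<close>. The form is therefore nondegenerate on the Euclidean
  orthogonal complement, which X \<mapsto> [X, y] maps isomorphically onto the tangent space. This
  also shows that the orbit has even dimension.\<close>

lemma centralizer_slice_symplectic_basis:
  fixes y :: "real^'n^'n"
  obtains d e where
    "\<And>i c. i < 2 * d \<Longrightarrow> bracket c y = 0 \<Longrightarrow> orthogonal c (e i)"
    "\<And>i j. i < 2 * d \<Longrightarrow> j < 2 * d \<Longrightarrow> kks_lift y (mat 1) (e i) (e j) = symplectic_unit i j"
    "dim (tangent_space y) = 2 * d"
proof -
  define C where "C = {X. bracket X y = 0}"
  define V where "V = {X. \<forall>c\<in>C. orthogonal c X}"
  have C: "subspace C" unfolding C_def by (rule subspace_centralizer)
  have V: "subspace V" by (auto simp: V_def subspace_def orthogonal_clauses)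
  have CV: "X = 0" if "X \<in> C" "X \<in> V" for X
    using that by (auto simp: V_def orthogonal_self)
  have decomp: "\<exists>c\<in>C. \<exists>v\<in>V. X = c + v" for X
  proof -
    obtain c v where "c \<in> span C" "\<And>w. w \<in> span C \<Longrightarrow> orthogonal v w" "X = c + v"
      using orthogonal_subspace_decomp_exists [of C X] by metis
    then have "c \<in> C" "v \<in> V"
      using span_eq_iff [THEN iffD2, OF C] by (auto simp: V_def orthogonal_commute [of v])
    then show ?thesis using \<open>X = c + v\<close> by blast
  qed
  have nondeg: "X = 0" if X: "X \<in> V" "\<And>Y. Y \<in> V \<Longrightarrow> kks_lift y (mat 1) X Y = 0" for X
  proof -
    \<comment> \<open>The hypothesis tests \<open>X\<close> only against the complement
      \<open>V\<close>; the centralizer pairs to zero with everything, so the test extends to all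
      \<open>Y\<close>.\<close>
    have "trace (bracket y X ** Y) = 0" for Y
    proof -
      obtain c v where cv: "c \<in> C" "v \<in> V" "Y = c + v" using decomp by blast
      have "trace (y ** bracket X v) = 0" using X(2) [OF cv(2)] by (simp add: kks_lift_def)
      moreover have "trace (y ** bracket X c) = 0"
      proof -
        have "bracket y c = 0" using cv(1) by (simp add: C_def bracket_minus_comm [of y])
        then have "trace (y ** bracket c X) = 0" by (simp add: trace_bracket_left trace_linear_simps)
        then show ?thesis
          by (simp add: bracket_minus_comm [of X] matrix_ring_simps trace_linear_simps)
      qed
      ultimately show ?thesis
        by (simp add: cv(3) matrix_ring_simps bracket_simps trace_linear_simps flip: trace_bracket_left)
    qed
    then have "bracket y X = 0" by (rule trace_nondegenerate)
    then have "X \<in> C" by (simp add: C_def bracket_minus_comm [of X])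
    then show "X = 0" using CV X(1) by blast
  qed
  obtain d e where e: "\<And>i. i < 2 * d \<Longrightarrow> e i \<in> V"
    "\<And>i j. i < 2 * d \<Longrightarrow> j < 2 * d \<Longrightarrow> kks_lift y (mat 1) (e i) (e j) = symplectic_unit i j"
    "V \<subseteq> span (e ` {..<2 * d})"
    using symplectic_basis_exists [OF bilinear_kks_lift [of y "mat 1"] kks_lift_alternating V nondeg] by metis
  have ind: "inj_on e {..<2 * d}" "independent (e ` {..<2 * d})"
    using symplectic_basis_independent [OF bilinear_kks_lift [of y "mat 1"] e(2)]
    by (intro independent_family; blast)+
  have dimV: "dim V = 2 * d"
    by (rule dim_unique [OF _ e(3) ind(2)]) (use e(1) ind(1) in \<open>auto simp: card_image\<close>)
  let ?ad = "\<lambda>X. bracket X y"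
  have lin: "linear ?ad" by (rule linearI) (simp_all add: bracket_simps)
  have "tangent_space y = ?ad ` V"
  proof -
    have "?ad X \<in> ?ad ` V" for X
    proof -
      obtain c v where cv: "c \<in> C" "v \<in> V" "X = c + v" using decomp by blast
      then have "?ad X = ?ad v" by (simp add: bracket_simps C_def)
      then show ?thesis using cv by blast
    qed
    then show ?thesis by (auto simp: tangent_space_eq)
  qed
  moreover have "inj_on ?ad (span V)"
  proof (rule inj_onI)
    fix X Y assume "X \<in> span V" "Y \<in> span V" "?ad X = ?ad Y"
    then have "X - Y \<in> V" "X - Y \<in> C"
      using V by (auto simp: span_eq_iff [THEN iffD2] subspace_diff C_def linear_diff [OF lin])
    then show "X = Y" using CV by fastforce
  qed
  ultimately have "dim (tangent_space y) = 2 * d"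
    using dim_image_eq [OF lin] dimV by simp
  then show thesis using that [of d e] e(1,2) by (auto simp: V_def C_def)
qed

section \<open>Charts of the orbit\<close>

text \<open>A scalar in the 2-form comes out to the power \<open>d\<close>; this is the source of
  the growth under scaling.\<close>

lemma wedge_power_cong:
  assumes "\<And>i j. i < 2 * d \<Longrightarrow> j < 2 * d \<Longrightarrow> \<omega> (v i) (v j) = s * \<omega>' (w i) (w j)"
  shows "wedge_power d \<omega> v = s ^ d * wedge_power d \<omega>' w"
proof -
  have "(\<Prod>i<d. \<omega> (v (p (2 * i))) (v (p (2 * i + 1)))) =
      s ^ d * (\<Prod>i<d. \<omega>' (w (p (2 * i))) (w (p (2 * i + 1))))" if "p permutes {..<2 * d}" for p
  proof -
    have "(\<Prod>i<d. \<omega> (v (p (2 * i))) (v (p (2 * i + 1)))) =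
        (\<Prod>i<d. s * \<omega>' (w (p (2 * i))) (w (p (2 * i + 1))))"
      using permutes_in_image [OF that] by (intro prod.cong assms) auto
    then show ?thesis by (simp add: prod.distrib)
  qed
  then have "(\<Sum>p | p permutes {..<2 * d}. of_int (sign p) * (\<Prod>i<d. \<omega> (v (p (2 * i))) (v (p (2 * i + 1))))) =
      s ^ d * (\<Sum>p | p permutes {..<2 * d}. of_int (sign p) * (\<Prod>i<d. \<omega>' (w (p (2 * i))) (w (p (2 * i + 1)))))"
    unfolding sum_distrib_left by (intro sum.cong) auto
  then show ?thesis by (simp add: wedge_power_def)
qed

text \<open>The vectors \<open>e i\<close> are orthogonal to the centralizer \<open>C\<close> of \<open>y\<close>. If two points \<open>g u\<close> and \<open>g v\<close> of the slice
  conjugate \<open>y\<close> to the same matrix, then \<open>g u - g v = g v c\<close> for some \<open>c\<close> in \<open>C\<close>, and \<open>(g v c) \<bullet> c = 0\<close>, so that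
  the assumption \<open>transversal\<close> gives \<open>c = 0\<close>. The same argument applies to the derivative.\<close>

locale orbit_chart =
  fixes x y :: "real^'n^'n" and d :: nat and e :: "nat \<Rightarrow> real^'n^'n" and r s :: real
  assumes s: "s > 0"
    and orbit: "s *\<^sub>R y \<in> adjoint_orbit x"
    and dim: "orbit_dim (adjoint_orbit x) = 2 * d"
    and orth: "\<And>i c. i < 2 * d \<Longrightarrow> bracket c y = 0 \<Longrightarrow> orthogonal c (e i)"
    and indep: "\<And>c k. (\<Sum>i<2 * d. c i *\<^sub>R e i) = 0 \<Longrightarrow> k < 2 * d \<Longrightarrow> c k = 0"
    and det_pos: "\<And>u. u \<in> {..<2 * d} \<rightarrow>\<^sub>E {-r<..<r} \<Longrightarrow> det (mat 1 + (\<Sum>i<2 * d. u i *\<^sub>R e i)) > 0"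
    and transversal: "\<And>u (c :: real^'n^'n). u \<in> {..<2 * d} \<rightarrow>\<^sub>E {-r<..<r} \<Longrightarrow> c \<noteq> 0 \<Longrightarrow>
      ((mat 1 + (\<Sum>i<2 * d. u i *\<^sub>R e i)) ** c) \<bullet> c \<noteq> 0"
begin

definition U :: "(nat \<Rightarrow> real) set" where
  "U = {..<2 * d} \<rightarrow>\<^sub>E {-r<..<r}"

definition g :: "(nat \<Rightarrow> real) \<Rightarrow> real^'n^'n" where
  "g u = mat 1 + (\<Sum>i<2 * d. u i *\<^sub>R e i)"

text \<open>The scale \<open>s\<close> is applied after conjugation. One slice, given by
  \<open>e\<close> and \<open>r\<close>, thus serves every scale, with bounds uniform in
  \<open>s\<close>.\<close>

definition \<phi> :: "(nat \<Rightarrow> real) \<Rightarrow> real^'n^'n" where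
  "\<phi> u = s *\<^sub>R (g u ** y ** matrix_inv (g u))"

lemma det_g: "u \<in> U \<Longrightarrow> det (g u) > 0" "u \<in> U \<Longrightarrow> det (g u) \<noteq> 0"
  using det_pos [where u = u] by (auto simp: U_def g_def)

lemma \<phi>_orbit: "u \<in> U \<Longrightarrow> \<phi> u \<in> adjoint_orbit x"
  using adjoint_orbit_conj [OF orbit det_g(1)] by (simp add: \<phi>_def matrix_ring_simps)

lemma transversal_combination:
  assumes "u \<in> U" "g u ** c = (\<Sum>i<2 * d. a i *\<^sub>R e i)" "bracket c y = 0"
  shows "c = 0"
proof (rule ccontr)
  assume "c \<noteq> 0"
  then have "(\<Sum>i<2 * d. a i *\<^sub>R e i) \<bullet> c \<noteq> 0"
    using transversal [where u = u and c = c] assms by (simp add: U_def g_def)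
  moreover have "(\<Sum>i<2 * d. a i *\<^sub>R e i) \<bullet> c = 0"
    using orth [OF _ assms(3)] by (simp add: inner_sum_left inner_sum_right orthogonal_def inner_commute [of _ c])
  ultimately show False by simp
qed

lemma g_update:
  assumes "i < 2 * d"
  shows "g (u(i := t)) = g u + (t - u i) *\<^sub>R e i"
proof -
  have "(\<Sum>j<2 * d. (u(i := t)) j *\<^sub>R e j) =
      (\<Sum>j<2 * d. u j *\<^sub>R e j + (if j = i then (t - u i) *\<^sub>R e i else 0))"
    by (rule sum.cong) (auto simp: scaleR_diff_left)
  also have "\<dots> = (\<Sum>j<2 * d. u j *\<^sub>R e j) + (t - u i) *\<^sub>R e i"
    using assms by (simp add: sum.distrib)
  finally show ?thesis by (simp add: g_def)
qed

lemma \<phi>_has_vector_derivative: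
  assumes "i < 2 * d" "u \<in> U"
  shows "((\<lambda>t. \<phi> (u(i := t))) has_vector_derivative bracket (e i ** matrix_inv (g u)) (\<phi> u)) (at (u i))"
  using bounded_linear.has_vector_derivative [OF bounded_linear_scaleR_right [of s]
      conj_line_has_vector_derivative [OF det_g(2) [OF assms(2)], of "u i" "e i" y]]
  by (simp add: \<phi>_def g_update assms(1) bracket_simps)

lemma partial_\<phi>:
  "i < 2 * d \<Longrightarrow> u \<in> U \<Longrightarrow> partial i \<phi> u = bracket (e i ** matrix_inv (g u)) (\<phi> u)"
  unfolding partial_def by (intro vector_derivative_at \<phi>_has_vector_derivative)

text \<open>The partial derivatives are continuous functions of the invertible matrix
  \<open>g u\<close>, so continuity in the product topology is settled here once.\<close>

lemma continuous_map_g_compose: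
  fixes F :: "real^'n^'n \<Rightarrow> 'b::topological_space"
  assumes "continuous_on {A. det A \<noteq> 0} F"
  shows "continuous_map (subtopology (powertop_real {..<2 * d}) U) euclidean (\<lambda>u. F (g u))"
proof -
  have 1: "continuous_map (powertop_real {..<2 * d}) euclidean (\<lambda>u. u i *\<^sub>R e i)" if "i < 2 * d" for i
  proof -
    have a: "continuous_map (powertop_real {..<2 * d}) euclideanreal (\<lambda>u. u i)"
      using that by (intro continuous_map_product_projection) auto
    have b: "continuous_map euclideanreal euclidean (\<lambda>t. t *\<^sub>R e i)"
      by (simp add: continuous_intros)
    show ?thesis using continuous_map_compose [OF a b] by (simp add: comp_def)
  qed
  have "continuous_map (powertop_real {..<2 * d}) euclidean g"
    unfolding g_def using 1 by (intro continuous_map_add continuous_map_sum) auto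
  then have a: "continuous_map (subtopology (powertop_real {..<2 * d}) U) (top_of_set {A. det A \<noteq> 0}) g"
    by (intro continuous_map_into_subtopology continuous_map_from_subtopology) (auto simp: det_g)
  have b: "continuous_map (top_of_set {A. det A \<noteq> 0}) euclidean F" using assms by simp
  show ?thesis using continuous_map_compose [OF a b] by (simp add: comp_def)
qed

lemma inj_\<phi>: "inj_on \<phi> U"
proof (rule inj_onI)
  fix u v assume uv: "u \<in> U" "v \<in> U" "\<phi> u = \<phi> v"
  note inv = matrix_inv [OF det_g(2) [OF uv(1)]] matrix_inv [OF det_g(2) [OF uv(2)]]
    matrix_inv_cancel [OF det_g(2) [OF uv(1)]] matrix_inv_cancel [OF det_g(2) [OF uv(2)]]
  have "g u ** y ** matrix_inv (g u) = g v ** y ** matrix_inv (g v)"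
    using uv(3) s by (simp add: \<phi>_def)
  then have "matrix_inv (g v) ** (g u ** y ** matrix_inv (g u)) ** g u =
      matrix_inv (g v) ** (g v ** y ** matrix_inv (g v)) ** g u" by simp
  then have "matrix_inv (g v) ** g u ** y = y ** matrix_inv (g v) ** g u"
    by (simp add: matrix_mul_assoc inv)
  then have "bracket (matrix_inv (g v) ** g u - mat 1) y = 0"
    by (simp add: bracket_def matrix_ring_simps)
  moreover have eq: "g v ** (matrix_inv (g v) ** g u - mat 1) = (\<Sum>i<2 * d. (u i - v i) *\<^sub>R e i)"
  proof -
    have "g v ** (matrix_inv (g v) ** g u - mat 1) = g u - g v"
      by (simp add: matrix_ring_simps inv)
    then show ?thesis by (simp add: g_def scaleR_diff_left sum_subtractf)
  qed
  ultimately have "matrix_inv (g v) ** g u - mat 1 = 0"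
    using transversal_combination [OF uv(2) eq] by simp
  then have "(\<Sum>i<2 * d. (u i - v i) *\<^sub>R e i) = 0" using eq by simp
  then have "u i = v i" if "i < 2 * d" for i using indep [of "\<lambda>i. u i - v i" i] that by simp
  then show "u = v" using uv(1,2) unfolding U_def by (intro PiE_ext) auto
qed

lemma independent_partials:
  assumes u: "u \<in> U"
  shows "inj_on (\<lambda>i. partial i \<phi> u) {..<2 * d}" "independent ((\<lambda>i. partial i \<phi> u) ` {..<2 * d})"
proof -
  have "c k = 0" if c: "(\<Sum>i<2 * d. c i *\<^sub>R partial i \<phi> u) = 0" and k: "k < 2 * d" for c k
  proof -
    define H where "H = (\<Sum>i<2 * d. c i *\<^sub>R e i)"
    define X where "X = matrix_inv (g u) ** H"
    note inv = matrix_inv [OF det_g(2) [OF u]] matrix_inv_cancel [OF det_g(2) [OF u]]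
    have gX: "g u ** X = H" by (simp add: X_def matrix_mul_assoc inv)
    have lin: "linear (\<lambda>E. bracket (E ** matrix_inv (g u)) (\<phi> u))"
      by (rule linearI) (simp_all add: bracket_simps matrix_ring_simps)
    have "bracket (H ** matrix_inv (g u)) (\<phi> u) = (\<Sum>i<2 * d. c i *\<^sub>R partial i \<phi> u)"
      unfolding H_def by (simp add: linear_sum [OF lin] linear_scale [OF lin] partial_\<phi> u)
    then have "bracket (g u ** X ** matrix_inv (g u)) (g u ** y ** matrix_inv (g u)) = 0"
      using c s by (simp add: gX \<phi>_def bracket_simps)
    then have "g u ** bracket X y ** matrix_inv (g u) = 0"
      using bracket_conj det_g(2) [OF u] by metis
    then have "matrix_inv (g u) ** (g u ** bracket X y ** matrix_inv (g u)) ** g u = 0" by simp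
    then have "bracket X y = 0" by (simp add: matrix_mul_assoc inv)
    then have "X = 0" using transversal_combination [OF u, of X c] gX by (simp add: H_def)
    then have "H = 0" using gX by simp
    then show "c k = 0" using indep k by (simp add: H_def)
  qed
  then show "inj_on (\<lambda>i. partial i \<phi> u) {..<2 * d}" "independent ((\<lambda>i. partial i \<phi> u) ` {..<2 * d})"
    by (intro independent_family; blast)+
qed

lemma parametrization_\<phi>: "parametrization (adjoint_orbit x) U \<phi>"
  unfolding parametrization_def dim
proof (intro conjI ballI)
  show "openin (powertop_real {..<2 * d}) U"
    unfolding U_def by (subst openin_PiE) auto
  show "\<phi> ` U \<subseteq> adjoint_orbit x" using \<phi>_orbit by blast
  show "inj_on \<phi> U" by (rule inj_\<phi>)
  show "C1_map (2 * d) U \<phi>"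
    unfolding C1_map_def
  proof (intro allI impI conjI ballI)
    fix i u assume "i < 2 * d" "u \<in> U"
    then show "(\<lambda>t. \<phi> (u(i := t))) differentiable at (u i)"
      using \<phi>_has_vector_derivative differentiableI_vector by blast
  next
    fix i assume i: "i < 2 * d"
    have "continuous_map (subtopology (powertop_real {..<2 * d}) U) euclidean
       (\<lambda>u. (\<lambda>A. bracket (e i ** matrix_inv A) (s *\<^sub>R (A ** y ** matrix_inv A))) (g u))"
      unfolding bracket_def by (rule continuous_map_g_compose) (auto intro!: continuous_intros)
    then show "continuous_map (subtopology (powertop_real {..<2 * d}) U) euclidean (partial i \<phi>)"
    proof (rule continuous_map_eq)
      fix u assume "u \<in> topspace (subtopology (powertop_real {..<2 * d}) U)"
      then have "u \<in> U" by simp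
      from partial_\<phi> [OF i this] show "bracket (e i ** matrix_inv (g u))
          (s *\<^sub>R (g u ** y ** matrix_inv (g u))) = partial i \<phi> u"
        by (simp only: \<phi>_def)
    qed
  qed
qed (use independent_partials in auto)

text \<open>The partial derivatives are brackets with \<open>\<phi> u\<close>, and invariance of the
  trace under conjugation moves the form back to \<open>y\<close>. Only one factor \<open>s\<close>
  per pair of arguments remains.\<close>

lemma liouville_form_\<phi>:
  assumes u: "u \<in> U"
  shows "liouville_form (adjoint_orbit x) (\<phi> u) (\<lambda>i. partial i \<phi> u) =
    s ^ d * wedge_power d (kks_lift y (g u)) e"
  unfolding liouville_form_def dim
proof (simp, rule wedge_power_cong)
  fix i j assume ij: "i < 2 * d" "j < 2 * d"
  let ?h = "matrix_inv (g u)"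
  have "\<phi> u ** bracket (e i ** ?h) (e j ** ?h) =
      s *\<^sub>R (g u ** (y ** bracket (?h ** e i) (?h ** e j)) ** ?h)"
    by (simp add: \<phi>_def bracket_def matrix_ring_simps scaleR_diff_right)
  then have "trace (\<phi> u ** bracket (e i ** ?h) (e j ** ?h)) = s * trace (y ** bracket (?h ** e i) (?h ** e j))"
    by (simp add: linear_scale [OF linear_trace] trace_conj det_g(2) [OF u])
  then show "kks_form (\<phi> u) (partial i \<phi> u) (partial j \<phi> u) = s * kks_lift y (g u) (e i) (e j)"
    by (simp add: partial_\<phi> ij u kks_form_bracket kks_lift_def)
qed

section \<open>The contribution of one chart to an integral\<close>

lemma measurable_g_compose:
  fixes F :: "real^'n^'n \<Rightarrow> 'b::topological_space"
  assumes "continuous_on {A. det A \<noteq> 0} F"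
  shows "(\<lambda>u. F (g u)) \<in> borel_measurable (restrict_space (\<Pi>\<^sub>M i\<in>{..<2 * d}. lborel) U)"
proof -
  have "(\<lambda>u. u i) \<in> borel_measurable (\<Pi>\<^sub>M i\<in>{..<2 * d}. lborel :: real measure)" if "i < 2 * d" for i
    using measurable_component_singleton [of i "{..<2 * d}" "\<lambda>_. lborel :: real measure"] that by simp
  then have "g \<in> borel_measurable (\<Pi>\<^sub>M i\<in>{..<2 * d}. lborel)"
    unfolding g_def by (intro borel_measurable_add borel_measurable_sum borel_measurable_scaleR) auto
  then have "g \<in> measurable (restrict_space (\<Pi>\<^sub>M i\<in>{..<2 * d}. lborel) U) (restrict_space borel {A. det A \<noteq> 0})"
    by (intro measurable_restrict_space3) (auto simp: det_g)
  moreover have "F \<in> borel_measurable (restrict_space borel {A. det A \<noteq> 0})"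
    using assms by (rule borel_measurable_continuous_on_restrict)
  ultimately show ?thesis by (rule measurable_compose)
qed

text \<open>The integrand is at least 1, the density at least \<open>s ^ d * \<delta>\<close>, and
  the cube has volume \<open>(2 * r) ^ (2 * d)\<close>.\<close>

lemma nn_integral_liouville_ge:
  assumes f: "f \<in> borel_measurable borel" "\<And>u. u \<in> U \<Longrightarrow> f (\<phi> u) \<ge> 1"
    and \<delta>: "\<delta> \<ge> 0" "\<And>u. u \<in> U \<Longrightarrow> wedge_power d (kks_lift y (g u)) e \<ge> \<delta>" and r: "r > 0"
  shows "(\<integral>\<^sup>+ z. f z \<partial>liouville_measure (adjoint_orbit x)) \<ge> ennreal (s ^ d * \<delta> * (2 * r) ^ (2 * d))"
proof -
  let ?O = "adjoint_orbit x"
  let ?P = "\<Pi>\<^sub>M i\<in>{..<2 * d}. lborel :: real measure"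
  let ?M = "restrict_space ?P U"
  let ?L = "\<lambda>u. s ^ d * wedge_power d (kks_lift y (g u)) e"
  let ?\<rho> = "\<lambda>u. ennreal \<bar>liouville_form ?O (\<phi> u) (\<lambda>i. partial i \<phi> u)\<bar>"
  let ?N = "restrict_space borel ?O"
  interpret product_sigma_finite "\<lambda>_. lborel :: real measure" ..
  have U: "U \<in> sets ?P"
    unfolding U_def by (intro sets_PiM_I_finite) auto
  have spM: "space ?M = U"
    using sets.sets_into_space [OF U] by (auto simp: space_restrict_space)
  have vol: "emeasure ?M (space ?M) = ennreal ((2 * r) ^ (2 * d))"
  proof -
    have "emeasure ?P U = (\<Prod>i<2 * d. emeasure lborel {-r<..<r})"
      unfolding U_def by (intro emeasure_PiM) auto
    also have "\<dots> = ennreal ((2 * r) ^ (2 * d))"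
      using r by (simp add: ennreal_power)
    finally show ?thesis
      unfolding spM using U sets.sets_into_space [OF U] by (subst emeasure_restrict_space) auto
  qed
  have "(\<lambda>u. (\<lambda>A. s *\<^sub>R (A ** y ** matrix_inv A)) (g u)) \<in> borel_measurable ?M"
    by (rule measurable_g_compose) (auto intro!: continuous_intros)
  then have "\<phi> \<in> borel_measurable ?M" unfolding \<phi>_def by simp
  then have \<phi>: "\<phi> \<in> measurable ?M ?N"
    by (intro measurable_restrict_space2) (auto simp: spM \<phi>_orbit)
  have "(\<lambda>u. (\<lambda>A. s ^ d * wedge_power d (kks_lift y A) e) (g u)) \<in> borel_measurable ?M"
    unfolding wedge_power_def kks_lift_def bracket_def
    by (rule measurable_g_compose) (auto intro!: continuous_intros)
  then have "?L \<in> borel_measurable ?M" by simp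
  moreover have "?\<rho> u = ennreal \<bar>?L u\<bar>" if "u \<in> space ?M" for u
    using that by (simp add: spM liouville_form_\<phi>)
  ultimately have \<rho>: "?\<rho> \<in> borel_measurable ?M"
    by (subst measurable_cong) auto
  have fN: "f \<in> borel_measurable ?N" using f(1) by (rule measurable_restrict_space1)
  have "ennreal (s ^ d * \<delta> * (2 * r) ^ (2 * d)) = ennreal (s ^ d * \<delta>) * emeasure ?M (space ?M)"
    unfolding vol using s \<delta>(1) r by (subst ennreal_mult [symmetric]) (auto simp: zero_le_mult_iff)
  also have "\<dots> = (\<integral>\<^sup>+ u. ennreal (s ^ d * \<delta>) \<partial>?M)" by simp
  also have "\<dots> \<le> (\<integral>\<^sup>+ u. ?\<rho> u * f (\<phi> u) \<partial>?M)"
  proof (rule nn_integral_mono)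
    fix u assume "u \<in> space ?M"
    then have u: "u \<in> U" by (simp add: spM)
    have "ennreal (s ^ d * \<delta>) * 1 \<le> ?\<rho> u * f (\<phi> u)"
      using s \<delta>(2) [OF u] f(2) [OF u] unfolding liouville_form_\<phi> [OF u]
      by (intro mult_mono ennreal_leI) (auto intro: order_trans [OF _ abs_ge_self] mult_left_mono)
    then show "ennreal (s ^ d * \<delta>) \<le> ?\<rho> u * f (\<phi> u)" by simp
  qed
  also have "\<dots> = (\<integral>\<^sup>+ u. f (\<phi> u) \<partial>density ?M ?\<rho>)"
    using \<rho> measurable_compose [OF \<phi> fN] by (subst nn_integral_density) auto
  also have "\<dots> = (\<integral>\<^sup>+ z. f z \<partial>chart_measure ?O U \<phi>)"
    unfolding chart_measure_def dim using \<phi> fN by (subst nn_integral_distr) (auto simp: measurable_density_eq1)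
  also have "\<dots> \<le> (\<integral>\<^sup>+ z. f z \<partial>liouville_measure ?O)"
  proof (rule nn_integral_mono_measure)
    let ?I = "{(U, \<phi>). parametrization ?O U \<phi>}"
    have mem: "(U, \<phi>) \<in> ?I" using parametrization_\<phi> by simp
    \<comment> \<open>The order on measures compares spaces and sigma-algebras before values; all
      chart measures live on the Borel sets of the orbit, hence so does their supremum.\<close>
    have "sets (liouville_measure ?O) = sets ?N"
      unfolding liouville_measure_def
      by (rule sets_SUP) (use mem in \<open>auto simp: chart_measure_def\<close>)
    then show "sets (chart_measure ?O U \<phi>) = sets (liouville_measure ?O)"
      by (simp add: chart_measure_def)
    show "chart_measure ?O U \<phi> \<le> liouville_measure ?O"
      unfolding liouville_measure_def using SUP_upper [OF mem, of "\<lambda>(U, \<phi>). chart_measure ?O U \<phi>"] by simp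
  qed
  finally show ?thesis .
qed

end

section \<open>Divergence of the partition function\<close>

text \<open>If \<open>x\<close> commuted with the rank one matrix \<open>outer v v\<close>, then
  \<open>v\<close> would be an eigenvector of \<open>x\<close>. Positive dimension makes the
  exponent of the scale factor positive.\<close>

lemma noncentral_tangent_space:
  fixes x :: "real^'n^'n"
  assumes "x \<in> sl" "x \<noteq> 0"
  shows "dim (tangent_space x) > 0"
proof (rule ccontr)
  assume "\<not> dim (tangent_space x) > 0"
  then have "tangent_space x \<subseteq> {0}" by simp
  then have zero: "bracket X x = 0" for X by (auto simp: tangent_space_eq)
  obtain v where v: "\<And>c. x *v v \<noteq> c *\<^sub>R v" using sl_not_scalar [OF assms] by blast
  have "v \<noteq> 0" using v [of 0] by auto
  have "outer v v ** x = x ** outer v v" using zero [of "outer v v"] by (simp add: bracket_def)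
  then have "outer v v *v (x *v v) = x *v (outer v v *v v)"
    by (simp add: matrix_vector_mul_assoc)
  then have "(v \<bullet> (x *v v)) *\<^sub>R v = (v \<bullet> v) *\<^sub>R (x *v v)"
    by (simp add: outer_mult_vec matrix_vector_mult_scaleR)
  then have "(1 / (v \<bullet> v)) *\<^sub>R ((v \<bullet> (x *v v)) *\<^sub>R v) = (1 / (v \<bullet> v)) *\<^sub>R ((v \<bullet> v) *\<^sub>R (x *v v))"
    by simp
  then have "x *v v = ((v \<bullet> (x *v v)) / (v \<bullet> v)) *\<^sub>R v"
    using \<open>v \<noteq> 0\<close> by simp
  then show False using v by blast
qed

text \<open>By Cauchy-Schwarz the perturbation \<open>(Z ** c) \<bullet> c\<close> is smaller than
  \<open>c \<bullet> c\<close> as soon as norm Z < 1 / K, a bound that is uniform in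
  \<open>c\<close>.\<close>

lemma eventually_transversal:
  "eventually (\<lambda>Z. \<forall>c :: real^'n^'n. c \<noteq> 0 \<longrightarrow> ((mat 1 + Z) ** c) \<bullet> c \<noteq> 0) (nhds (0 :: real^'n^'n))"
proof -
  obtain K where K: "K > 0" "\<And>(Z :: real^'n^'n) (c :: real^'n^'n). norm (Z ** c) \<le> norm Z * norm c * K"
    using matmul.pos_bounded by blast
  have "eventually (\<lambda>Z :: real^'n^'n. norm Z < 1 / K) (nhds 0)"
    using K(1) eventually_nhds_metric [of "\<lambda>Z :: real^'n^'n. norm Z < 1 / K" 0]
    by (auto intro!: exI [of _ "1 / K"] simp: dist_norm)
  then show ?thesis
  proof (rule eventually_mono)
    fix Z :: "real^'n^'n" assume Z: "norm Z < 1 / K"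
    have "((mat 1 + Z) ** c) \<bullet> c \<noteq> 0" if "c \<noteq> 0" for c :: "real^'n^'n"
    proof -
      have "\<bar>(Z ** c) \<bullet> c\<bar> \<le> norm (Z ** c) * norm c" by (rule Cauchy_Schwarz_ineq2)
      also have "\<dots> \<le> norm Z * norm c * K * norm c" by (intro mult_right_mono K) auto
      also have "\<dots> = (norm Z * K) * (norm c)\<^sup>2" by (simp add: power2_eq_square)
      also have "\<dots> < 1 * (norm c)\<^sup>2"
        using Z K(1) that by (intro mult_strict_right_mono) (auto simp: field_simps)
      finally have "\<bar>(Z ** c) \<bullet> c\<bar> < c \<bullet> c" by (simp add: power2_norm_eq_inner)
      then show ?thesis by (auto simp: matrix_ring_simps inner_add_left)
    qed
    then show "\<forall>c :: real^'n^'n. c \<noteq> 0 \<longrightarrow> ((mat 1 + Z) ** c) \<bullet> c \<noteq> 0" by blast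
  qed
qed

lemma nn_integral_exp_killing_infinite:
  fixes x \<beta> :: "real^'n^'n"
  assumes n: "CARD('n) \<ge> 3" and x: "x \<in> sl" "nilpotent_matrix x" "x \<noteq> 0" and \<beta>: "\<beta> \<in> sl"
  shows "(\<integral>\<^sup>+ y. ennreal (exp (- killing y \<beta>)) \<partial>liouville_measure (adjoint_orbit x)) = \<infinity>"
proof -
  let ?O = "adjoint_orbit x"
  have x_orbit: "x \<in> ?O"
    unfolding adjoint_orbit_iff by (intro exI [of _ "mat 1"]) simp
  obtain y where y: "y \<in> ?O" "\<beta> = 0 \<or> trace (y ** \<beta>) < 0"
    using exists_orbit_trace_negative [OF n x(1,3) \<beta>] x_orbit by blast
  obtain d e where e: "\<And>i c. i < 2 * d \<Longrightarrow> bracket c y = 0 \<Longrightarrow> orthogonal c (e i)"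
    "\<And>i j. i < 2 * d \<Longrightarrow> j < 2 * d \<Longrightarrow> kks_lift y (mat 1) (e i) (e j) = symplectic_unit i j"
    and dim: "dim (tangent_space y) = 2 * d"
    using centralizer_slice_symplectic_basis [of y] by metis
  have d: "d > 0"
    using noncentral_tangent_space [OF x(1,3)] orbit_dim_eq [OF y(1)] orbit_dim_eq [OF x_orbit] dim by simp
  have indep: "c k = 0" if "(\<Sum>i<2 * d. c i *\<^sub>R e i) = 0" "k < 2 * d" for c k
    using symplectic_basis_independent [OF bilinear_kks_lift e(2) that] by blast
  define L where "L A = wedge_power d (kks_lift y A) e" for A
  \<comment> \<open>Half of the positive value at the identity, so that continuity keeps the top
    power above \<delta> nearby.\<close>
  define \<delta> where "\<delta> = L (mat 1) / 2"
  have \<delta>: "\<delta> > 0" "\<delta> < L (mat 1)"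
    using wedge_power_symplectic_basis_pos [of d "kks_lift y (mat 1)" e] e(2)
    by (auto simp: \<delta>_def L_def)
  let ?D = "{Z :: real^'n^'n. det (mat 1 + Z) > 0}"
  have D: "open ?D" "0 \<in> ?D"
    by (auto intro!: open_Collect_less continuous_intros)
  have tends: "(F \<longlongrightarrow> F 0) (nhds 0)" if "continuous_on ?D F" for F :: "real^'n^'n \<Rightarrow> real"
    using that D by (metis continuous_on_eq_continuous_at isCont_def tendsto_at_iff_tendsto_nhds)
  have "continuous_on ?D (\<lambda>Z. L (mat 1 + Z))"
    unfolding L_def wedge_power_def kks_lift_def bracket_def by (auto intro!: continuous_intros)
  from order_tendstoD(1) [OF tends [OF this], of \<delta>]
  have ev1: "eventually (\<lambda>Z. L (mat 1 + Z) > \<delta>) (nhds 0)" using \<delta> by simp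
  have ev2: "eventually (\<lambda>Z. trace ((mat 1 + Z) ** y ** matrix_inv (mat 1 + Z) ** \<beta>) \<le> 0) (nhds 0)"
  proof (cases "\<beta> = 0")
    case False
    have "continuous_on ?D (\<lambda>Z. trace ((mat 1 + Z) ** y ** matrix_inv (mat 1 + Z) ** \<beta>))"
      by (auto intro!: continuous_intros)
    from order_tendstoD(2) [OF tends [OF this], of 0]
    have "eventually (\<lambda>Z. trace ((mat 1 + Z) ** y ** matrix_inv (mat 1 + Z) ** \<beta>) < 0) (nhds 0)"
      using y(2) False by simp
    then show ?thesis by (rule eventually_mono) simp
  qed (simp add: linear_0 [OF linear_trace])
  have ev3: "eventually (\<lambda>Z. Z \<in> ?D) (nhds 0)" using D by (rule eventually_nhds_in_open)
  obtain \<epsilon> where \<epsilon>: "\<epsilon> > 0" and near: "\<And>Z. norm Z < \<epsilon> \<Longrightarrow> L (mat 1 + Z) > \<delta> \<and>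
      trace ((mat 1 + Z) ** y ** matrix_inv (mat 1 + Z) ** \<beta>) \<le> 0 \<and> det (mat 1 + Z) > 0 \<and>
      (\<forall>c :: real^'n^'n. c \<noteq> 0 \<longrightarrow> ((mat 1 + Z) ** c) \<bullet> c \<noteq> 0)"
    using eventually_conj [OF ev1 eventually_conj [OF ev2 eventually_conj [OF ev3 eventually_transversal]]]
    unfolding eventually_nhds_metric by (auto simp: dist_norm)
  \<comment> \<open>Chosen so that the cube of half-width \<open>r\<close> lands in the
    \<epsilon>-ball; the summand 1 keeps the denominator positive and the final inequality
    strict.\<close>
  define r where "r = \<epsilon> / (1 + (\<Sum>i<2 * d. norm (e i)))"
  have pos: "1 + (\<Sum>i<2 * d. norm (e i)) > 0" by (simp add: add_pos_nonneg sum_nonneg)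
  then have r: "r > 0" using \<epsilon> by (simp add: r_def)
  have small: "norm (\<Sum>i<2 * d. u i *\<^sub>R e i) < \<epsilon>" if "u \<in> {..<2 * d} \<rightarrow>\<^sub>E {-r<..<r}" for u
  proof -
    have "norm (\<Sum>i<2 * d. u i *\<^sub>R e i) \<le> (\<Sum>i<2 * d. r * norm (e i))"
    proof (rule sum_norm_le)
      fix i assume "i \<in> {..<2 * d}"
      then have "u i \<in> {-r<..<r}" using that by blast
      then have "\<bar>u i\<bar> \<le> r" by auto
      then show "norm (u i *\<^sub>R e i) \<le> r * norm (e i)" by (simp add: mult_right_mono)
    qed
    also have "\<dots> < r * (1 + (\<Sum>i<2 * d. norm (e i)))"
      using r by (simp add: sum_distrib_left distrib_left)
    also have "\<dots> = \<epsilon>" using pos by (simp add: r_def)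
    finally show ?thesis .
  qed
  let ?I = "\<integral>\<^sup>+ z. ennreal (exp (- killing z \<beta>)) \<partial>liouville_measure ?O"
  have tr\<beta>: "trace \<beta> = 0" using \<beta> by (simp add: sl_def)
  have bound: "ennreal (t\<^sup>2 ^ d * \<delta> * (2 * r) ^ (2 * d)) \<le> ?I" if "t \<noteq> 0" for t
  proof -
    interpret orbit_chart x y d e r "t\<^sup>2"
    proof
      show "t\<^sup>2 > 0" using that by simp
      show "t\<^sup>2 *\<^sub>R y \<in> ?O" using nilpotent_orbit_cone [OF x(2) y(1) that] .
      show "orbit_dim ?O = 2 * d" using orbit_dim_eq [OF y(1)] dim by simp
    qed (use e(1) indep near small in blast)+
    have gU: "norm (\<Sum>i<2 * d. u i *\<^sub>R e i) < \<epsilon>" if "u \<in> U" for u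
      using small that by (simp add: U_def)
    show ?thesis
    proof (rule nn_integral_liouville_ge)
      have "continuous_on UNIV (\<lambda>z. exp (- killing z \<beta>))"
        unfolding killing_eq by (intro continuous_intros)
      then show "(\<lambda>z. ennreal (exp (- killing z \<beta>))) \<in> borel_measurable borel"
        by (intro measurable_compose [OF _ measurable_ennreal] borel_measurable_continuous_onI)
      show "1 \<le> ennreal (exp (- killing (\<phi> u) \<beta>))" if "u \<in> U" for u
      proof -
        have "trace (g u ** y ** matrix_inv (g u) ** \<beta>) \<le> 0"
          using near [OF gU [OF that]] by (simp add: g_def)
        then have "trace (\<phi> u ** \<beta>) \<le> 0"
          by (simp add: \<phi>_def matrix_ring_simps linear_scale [OF linear_trace] mult_nonneg_nonpos)
        then have "killing (\<phi> u) \<beta> \<le> 0"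
          by (simp add: killing_eq tr\<beta> mult_nonneg_nonpos)
        then show ?thesis by (simp flip: ennreal_1)
      qed
      show "\<delta> \<le> wedge_power d (kks_lift y (g u)) e" if "u \<in> U" for u
        using near [OF gU [OF that]] by (simp add: g_def L_def)
    qed (use \<delta> r in auto)
  qed
  have "of_nat k \<le> ?I" for k :: nat
  proof -
    define C where "C = \<delta> * (2 * r) ^ (2 * d)"
    have C: "C > 0" using \<delta> r by (simp add: C_def)
    \<comment> \<open>From t \<ge> 1 and d > 0 follows that \<open>t\<close> is at most its power
      \<open>2 * d\<close>, so the bound is at least t C, and the second entry of the maximum makes
      this at least k.\<close>
    define t where "t = max 1 (real k / C)"
    have t: "t \<ge> 1" "t * C \<ge> real k" using C by (auto simp: t_def max_def field_simps)
    have "t \<le> t\<^sup>2 ^ d"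
      using power_increasing [of 1 "2 * d" t] t(1) d by (simp add: power_mult)
    then have "real k \<le> t\<^sup>2 ^ d * C" using t(2) C by (meson mult_right_mono less_imp_le order_trans)
    then have "of_nat k \<le> ennreal (t\<^sup>2 ^ d * C)"
      by (metis ennreal_leI ennreal_of_nat_eq_real_of_nat)
    also have "\<dots> \<le> ?I" using bound [of t] t(1) by (simp add: C_def mult.assoc)
    finally show "of_nat k \<le> ?I" .
  qed
  then have "\<not> ?I < top" using ennreal_Ex_less_of_nat [of ?I] leD by blast
  then show ?thesis using top.not_eq_extremum [of ?I] unfolding infinity_ennreal_def by blast
qed

theorem mainTheorem1:
  fixes x :: "real^'n^'n"
  assumes "CARD('n) \<ge> 3"
    and "x \<in> sl" and "nilpotent_matrix x" and "x \<noteq> 0"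
  shows "gibbs_domain (adjoint_orbit x) = {} \<and>
    (\<forall>\<beta>\<in>sl. (\<integral>\<^sup>+ y. ennreal (exp (- killing y \<beta>)) \<partial>liouville_measure (adjoint_orbit x)) = \<infinity>)"
  using nn_integral_exp_killing_infinite [OF assms] by (simp add: gibbs_domain_def partition_function_def)

end
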